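(* Let $n \ge 3$ and let $G$ be a finite simple graph of order $n$ which is either Eulerian or $2$-edge-connected. Then $$W(G) \le W(C_n), \qquad H(G) \ge H(C_n), \qquad M_1(G) \ge M_1(C_n),$$ and in each of these three inequalities equality holds if and only if $G \cong C_n$.
   Context: Graphs are finite and simple. $C_n$ denotes the cycle on $n$ vertices. An Eulerian graph is a connected graph in which every vertex has even degree. A graph is $2$-edge-connected if it is connected and remains connected after deleting any single edge. For a graph $G=(V,E)$ with distance function $d(u,v)$: the Wiener index is $W(G)=\sum_{\{u,v\}\subseteq V,\,u\neq v} d(u,v)$; the Harary index is $H(G)=\sum_{\{u,v\}\subseteq V,\,u\ne v} \frac{1}{d(u,v)}$; the first Zagreb index is $M_1(G)=\sum_{v\in V}\deg(v)^2$. *)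

theory Defs
  imports
    "Graph_Theory.Digraph_Component"
    "Graph_Theory.Digraph_Isomorphism"
    "Graph_Theory.Shortest_Path"
begin

text \<open>
  Finite simple graphs are \<open>pair_graph\<close>s: an undirected edge \<open>{u, v}\<close> is represented by the two
  arcs \<open>(u, v)\<close> and \<open>(v, u)\<close>, so the degree of a vertex is its out-degree.
\<close>

definition eulerian_graph :: "'a pair_pre_digraph \<Rightarrow> bool" where
  "eulerian_graph G \<longleftrightarrow>
     Digraph_Component.connected (with_proj G) \<and>
     (\<forall>v \<in> pverts G. even (out_degree (with_proj G) v))"

definition del_edge :: "'a pair_pre_digraph \<Rightarrow> 'a \<Rightarrow> 'a \<Rightarrow> 'a pair_pre_digraph" where
  "del_edge G u v = G\<lparr>parcs := parcs G - {(u, v), (v, u)}\<rparr>"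

definition two_edge_connected :: "'a pair_pre_digraph \<Rightarrow> bool" where
  "two_edge_connected G \<longleftrightarrow>
     Digraph_Component.connected (with_proj G) \<and>
     (\<forall>(u, v) \<in> parcs G. Digraph_Component.connected (with_proj (del_edge G u v)))"

text \<open>
  The least length of a walk from \<open>u\<close> to \<open>v\<close>; the conversion to a real number sends the infinite
  distance between vertices of different components to 0.
\<close>

definition graph_dist :: "'a pair_pre_digraph \<Rightarrow> 'a \<Rightarrow> 'a \<Rightarrow> real" where
  "graph_dist G u v = real_of_ereal (wf_digraph.\<mu> (with_proj G) (\<lambda>_. 1) u v)"

text \<open>
  The distance as a function of the unordered pair \<open>{u, v}\<close>, well defined by symmetry
  (lemma \<open>pair_dist_eq\<close>).
\<close>

definition pair_dist :: "'a pair_pre_digraph \<Rightarrow> 'a set \<Rightarrow> real" where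
  "pair_dist G e = (THE d. \<exists>u v. e = {u, v} \<and> d = graph_dist G u v)"

definition wiener_index :: "'a pair_pre_digraph \<Rightarrow> real" where
  "wiener_index G = (\<Sum>e | e \<subseteq> pverts G \<and> card e = 2. pair_dist G e)"

definition harary_index :: "'a pair_pre_digraph \<Rightarrow> real" where
  "harary_index G = (\<Sum>e | e \<subseteq> pverts G \<and> card e = 2. 1 / pair_dist G e)"

definition first_zagreb_index :: "'a pair_pre_digraph \<Rightarrow> nat" where
  "first_zagreb_index G = (\<Sum>v \<in> pverts G. (out_degree (with_proj G) v)\<^sup>2)"

text \<open>A simple graph for \<open>n \<ge> 3\<close> only.\<close>

definition cycle_graph :: "nat \<Rightarrow> nat pair_pre_digraph" where
  "cycle_graph n =
     \<lparr>pverts = {0..<n},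
      parcs = {(i, j). i < n \<and> j < n \<and> (j = (i + 1) mod n \<or> i = (j + 1) mod n)}\<rparr>"

lemma pair_graph_cycle_graph:
  assumes "n \<ge> 3"
  shows "pair_graph (cycle_graph n)"
proof
  show "finite (parcs (cycle_graph n))"
    by (rule finite_subset[of _ "{0..<n} \<times> {0..<n}"]) (auto simp: cycle_graph_def)
  show "symmetric (with_proj (cycle_graph n))"
    by (auto simp: symmetric_def cycle_graph_def intro!: symI)
  fix e assume "e \<in> parcs (cycle_graph n)"
  moreover have "Suc i mod n \<noteq> i" if "i < n" for i
    using that assms by (cases "Suc i = n") auto
  ultimately show "fst e \<noteq> snd e"
    by (cases e) (force simp: cycle_graph_def)
qed (auto simp: cycle_graph_def)

lemma graph_dist_commute:
  assumes "pair_graph G"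
  shows "graph_dist G u v = graph_dist G v u"
proof -
  interpret pair_graph G by fact
  have len: "awalk_cost (\<lambda>_. 1) (rev_path p) = awalk_cost (\<lambda>_. 1) p" for p :: "('a \<times> 'a) list"
    by (induction p) auto
  have "(\<lambda>p. ereal (awalk_cost (\<lambda>_. 1) p)) ` {p. awalk u p v} \<subseteq>
        (\<lambda>p. ereal (awalk_cost (\<lambda>_. 1) p)) ` {p. awalk v p u}" for u v
  proof (rule image_subsetI)
    fix p assume "p \<in> {p. awalk u p v}"
    then show "ereal (awalk_cost (\<lambda>_. 1) p) \<in> (\<lambda>p. ereal (awalk_cost (\<lambda>_. 1) p)) ` {p. awalk v p u}"
      by (intro image_eqI[of _ _ "rev_path p"]) (auto simp: len)
  qed
  then have "\<mu> (\<lambda>_. 1) u v = \<mu> (\<lambda>_. 1) v u"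
    unfolding \<mu>_def by (intro arg_cong[of _ _ Inf] equalityI)
  then show ?thesis
    by (simp add: graph_dist_def)
qed

lemma pair_dist_eq:
  assumes "pair_graph G"
  shows "pair_dist G {u, v} = graph_dist G u v"
  unfolding pair_dist_def
  by (rule the_equality) (auto simp: doubleton_eq_iff graph_dist_commute[OF assms])

end

theory Submission
  imports Defs
begin

text \<open>
  An Eulerian graph is bridgeless by the handshake lemma, so only 2-edge-connected graphs matter.
  Let \<open>\<phi>\<close> be strictly increasing (\<open>\<phi> k = k\<close> for the Wiener and \<open>\<phi> k = - 1 / k\<close> for the Harary index).

  If \<open>G\<close> has no cut vertex, every level of a breadth-first search, apart from the root and the last
  level, has at least two vertices. Hence the \<open>i\<close>-th closest vertex is at distance at most
  \<open>\<lceil>i / 2\<rceil>\<close>, as in a cycle, and equality forces all degrees to be 2.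

  If \<open>c\<close> is a cut vertex, \<open>G\<close> is two smaller bridgeless graphs with \<open>a + 1\<close> and \<open>b + 1\<close> vertices glued at
  \<open>c\<close>, and induction applies to both. For the distances between the two parts we use that in a bridgeless
  graph two consecutive levels have at least three vertices in total, so that distances from \<open>c\<close> grow
  at most like two thirds of the rank. This beats the cycle on \<open>a + b + 1\<close> vertices strictly.

  So equality holds exactly for the connected 2-regular graphs, which are the cycles. The same degree
  condition decides equality for the Zagreb index, as all degrees are at least 2.
\<close>

section \<open>The index of the cycle under gluing\<close>

text \<open>The sum of \<open>\<phi> (d u v)\<close> over the ordered pairs of distinct vertices of the cycle on \<open>n\<close> vertices.\<close>

definition cycle_sum :: "(nat \<Rightarrow> real) \<Rightarrow> nat \<Rightarrow> real" where
  "cycle_sum \<phi> n = real n * (\<Sum>i = 1..n - 1. \<phi> ((i + 1) div 2))"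

text \<open>The sum is \<open>(n + 1)^2 / 4\<close> rounded down. The \<open>mod\<close> term is the
  rounding error, kept so that the closed form needs no division.\<close>

lemma sum_ceil_half: "4 * (\<Sum>i = 1..n. (i + 1) div 2) + (n + 1) mod 2 = (n + 1)\<^sup>2" for n :: nat
proof (induction n)
  case (Suc n)
  have "(Suc n + 1) mod 2 + 4 * ((Suc n + 1) div 2) = (n + 1) mod 2 + 2 * (n + 1) + 1"
  proof (cases "even n")
    case True
    then obtain k where "n = 2 * k" ..
    then show ?thesis by simp
  next
    case False
    then obtain k where "n = 2 * k + 1" ..
    then show ?thesis by simp
  qed
  moreover have "(Suc n + 1)\<^sup>2 = (n + 1)\<^sup>2 + 2 * (n + 1) + 1"
    by (simp add: power2_eq_square)
  moreover have "(\<Sum>i = 1..Suc n. (i + 1) div 2) = (\<Sum>i = 1..n. (i + 1) div 2) + (Suc n + 1) div 2"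
    by simp
  ultimately show ?case
    using Suc by linarith
qed simp

text \<open>Rounding loses at most 1/4 in that closed form; multiplying by \<open>n + 1\<close>
  gives cubic bounds free of parity.\<close>

lemma cycle_sum_real_bounds:
  fixes n :: nat
  shows "4 * cycle_sum real (n + 1) \<le> (real n + 1) ^ 3"
    and "(real n + 1) ^ 3 - (real n + 1) \<le> 4 * cycle_sum real (n + 1)"
proof -
  define s where "s = (\<Sum>i = 1..n. (i + 1) div 2)"
  have "4 * s \<le> (n + 1)\<^sup>2" "(n + 1)\<^sup>2 \<le> 4 * s + 1"
    using sum_ceil_half[of n] unfolding s_def by linarith+
  then have "4 * real s \<le> (real n + 1)\<^sup>2" "(real n + 1)\<^sup>2 \<le> 4 * real s + 1"
    by (simp_all flip: of_nat_le_iff[where 'a = real] add: add.commute)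
  then have "(real n + 1) * (4 * real s) \<le> (real n + 1) * (real n + 1)\<^sup>2"
    "(real n + 1) * (real n + 1)\<^sup>2 \<le> (real n + 1) * (4 * real s + 1)"
    by (intro mult_left_mono; simp)+
  moreover have "cycle_sum real (n + 1) = (real n + 1) * real s"
    by (simp add: cycle_sum_def s_def)
  ultimately show "4 * cycle_sum real (n + 1) \<le> (real n + 1) ^ 3"
    "(real n + 1) ^ 3 - (real n + 1) \<le> 4 * cycle_sum real (n + 1)"
    by (simp_all add: power2_eq_square power3_eq_cube algebra_simps)
qed

text \<open>\<open>A\<close> and \<open>B\<close> stand for the sums of distances from the gluing
  vertex to the \<open>a\<close> and \<open>b\<close> other vertices of the two parts. Each distance
  enters once for every vertex of the opposite part.\<close>

lemma cycle_sum_real_superadditive: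
  fixes a b :: nat and A B :: real
  assumes "a \<ge> 2" "b \<ge> 2" and A: "3 * A \<le> real (a\<^sup>2 + a)" and B: "3 * B \<le> real (b\<^sup>2 + b)"
  shows "cycle_sum real (a + 1) + cycle_sum real (b + 1) + 2 * (real b * A + real a * B)
    < cycle_sum real (a + b + 1)"
proof -
  define x y where "x = real a" and "y = real b"
  have xy: "x \<ge> 2" "y \<ge> 2"
    using assms by (simp_all add: x_def y_def)
  have "y * (3 * A) \<le> y * (x\<^sup>2 + x)" "x * (3 * B) \<le> x * (y\<^sup>2 + y)"
    using A B xy by (auto intro!: mult_left_mono simp: x_def y_def)
  then have AB: "3 * (y * A + x * B) \<le> x * y * (x + y + 2)"
    by (simp add: power2_eq_square algebra_simps)
  have "2 * 2 \<le> x * y"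
    using xy by (intro mult_mono) auto
  \<comment> \<open>What the cubic bounds and \<open>AB\<close> leave of four times the difference
    of the two sides; it is positive because \<open>x * y > 3\<close>.\<close>
  then have "0 < (x + y + 2) * (x * y / 3 - 1)"
    using xy by (intro mult_pos_pos) auto
  moreover have "4 * cycle_sum real (a + 1) \<le> (x + 1) ^ 3" "4 * cycle_sum real (b + 1) \<le> (y + 1) ^ 3"
    "(x + y + 1) ^ 3 - (x + y + 1) \<le> 4 * cycle_sum real (a + b + 1)"
    using cycle_sum_real_bounds(1)[of a] cycle_sum_real_bounds(1)[of b]
      cycle_sum_real_bounds(2)[of "a + b"] by (simp_all add: x_def y_def)
  ultimately show ?thesis
    using AB unfolding x_def[symmetric] y_def[symmetric]
    by (simp add: power2_eq_square power3_eq_cube algebra_simps)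
qed

section \<open>Reciprocals and the grid of second differences\<close>

abbreviation recip :: "nat \<Rightarrow> real" where
  "recip k \<equiv> 1 / real k"

text \<open>Half the second difference of \<open>cycle_sum recip\<close> centred at
  \<open>s\<close>, for \<open>s >= 2\<close>.\<close>

definition even_recip :: "nat \<Rightarrow> real" where
  "even_recip s = (if even s then 2 / real s else 0)"

text \<open>The coefficients \<open>n\<close>, \<open>- 2 * (n + 1)\<close> and \<open>n + 2\<close>
  add up to zero, so the common partial sum cancels and only the last two reciprocals survive. These
  cancel as well when \<open>n\<close> is even.\<close>

lemma cycle_sum_recip_second_difference:
  assumes "n \<ge> 1"
  shows "cycle_sum recip (n + 2) - 2 * cycle_sum recip (n + 1) + cycle_sum recip n
    = 2 * even_recip (n + 1)"
proof -
  obtain m where m: "n = Suc m"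
    using assms by (cases n) auto
  define S where "S = (\<Sum>i = 1..m. recip ((i + 1) div 2))"
  have c: "cycle_sum recip n = real n * S"
    "cycle_sum recip (n + 1) = real (n + 1) * (S + recip ((n + 1) div 2))"
    "cycle_sum recip (n + 2) = real (n + 2) * (S + recip ((n + 1) div 2) + recip ((n + 2) div 2))"
    by (simp_all add: cycle_sum_def S_def m)
  show ?thesis
  proof (cases "even n")
    case True
    then obtain k where k: "n = 2 * k" by auto
    define p q where "p = 1 / real k" and "q = 1 / real (k + 1)"
    have pq: "real k * p = 1" "(real k + 1) * q = 1"
      using m k by (auto simp: p_def q_def)
    have "(n + 1) div 2 = k" "(n + 2) div 2 = k + 1"
      by (simp_all add: k)
    then have "cycle_sum recip (n + 2) - 2 * cycle_sum recip (n + 1) + cycle_sum recip n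
      = 2 * ((real k + 1) * q) - 2 * (real k * p)"
      unfolding c by (simp only: p_def[symmetric] q_def[symmetric]) (simp add: k algebra_simps)
    then show ?thesis
      using True pq by (simp add: even_recip_def)
  next
    case False
    then obtain k where k: "n = 2 * k + 1" by (auto elim: oddE)
    define q where "q = 1 / real (k + 1)"
    have "(n + 1) div 2 = k + 1" "(n + 2) div 2 = k + 1"
      by (simp_all add: k)
    then have "cycle_sum recip (n + 2) - 2 * cycle_sum recip (n + 1) + cycle_sum recip n = 2 * q"
      unfolding c by (simp only: q_def[symmetric]) (simp add: k algebra_simps)
    moreover have "2 / real (n + 1) = q"
      by (simp add: k q_def field_simps)
    ultimately show ?thesis
      using False by (simp add: even_recip_def)
  qed
qed

text \<open>The second differences telescope along each row and then over the rows; the boundary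
  vanishes because \<open>cycle_sum recip 1 = 0\<close>. The grid has one cell for each pair of
  vertices on different sides of a gluing vertex.\<close>

lemma cycle_sum_recip_grid:
  "cycle_sum recip (a + b + 1) - cycle_sum recip (a + 1) - cycle_sum recip (b + 1)
    = 2 * (\<Sum>i = 1..a. \<Sum>k = 1..b. even_recip (i + k))"
proof -
  have row: "cycle_sum recip (i + b + 1) - cycle_sum recip (i + b) - cycle_sum recip (i + 1) + cycle_sum recip i
    = 2 * (\<Sum>k = 1..b. even_recip (i + k))" if "i \<ge> 1" for i
  proof (induction b)
    case (Suc b)
    then show ?case
      using cycle_sum_recip_second_difference[of "i + b"] that by simp
  qed simp
  show ?thesis
  proof (induction a)
    case 0
    show ?case by (simp add: cycle_sum_def)
  next
    case (Suc a)
    show ?case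
      using Suc row[of "Suc a"] by simp
  qed
qed

text \<open>
  The largest possible distance of the \<open>i\<close>-th closest vertex in a bridgeless graph: the extremal
  levels have sizes 2, 1, 2, 1, and so on.
\<close>

definition rank_bound :: "nat \<Rightarrow> nat" where
  "rank_bound i = (2 * i + 1) div 3"

lemma rank_bound_le: "3 * real (rank_bound i) \<le> 2 * real i + 1"
proof -
  have "3 * rank_bound i \<le> 2 * i + 1"
    by (simp add: rank_bound_def)
  then show ?thesis
    by (simp flip: of_nat_le_iff[where 'a = real])
qed

lemma recip_rank_bound_ge:
  assumes "i \<ge> 1" "k \<ge> 1"
  shows "3 / (2 * (real (i + k) + 1)) \<le> recip (rank_bound i + rank_bound k)"
proof -
  \<comment> \<open>Rules out a zero denominator, whose reciprocal would be 0.\<close>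
  have "rank_bound i \<ge> 1"
    using assms by (simp add: rank_bound_def)
  then have "0 < real (rank_bound i + rank_bound k)"
    by simp
  moreover have "3 * real (rank_bound i + rank_bound k) \<le> 2 * (real (i + k) + 1)"
    using rank_bound_le[of i] rank_bound_le[of k] by simp
  ultimately show ?thesis
    by (simp add: field_simps)
qed

text \<open>
  The subtracted term lives on the even cells of a checkerboard only, and the sum over
  each domino \<open>(i, 2k + 1), (i, 2k + 2)\<close>, or its transpose, is nonnegative.
  When \<open>a\<close> and \<open>b\<close> are odd, the surplus of the domino \<open>(2, 1), (2, 2)\<close> pays for the single cell left over.
\<close>

definition grid_term :: "nat \<Rightarrow> nat \<Rightarrow> real" where
  "grid_term i k = recip (rank_bound i + rank_bound k) - even_recip (i + k)"

lemma grid_term_commute: "grid_term i k = grid_term k i"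
  by (simp add: grid_term_def add.commute)

text \<open>Exactly one of the two cells has an even coordinate sum \<open>s\<close>, and the linear
  bounds on both reciprocals together outweigh \<open>2 / s\<close>. The corner domino is too tight
  for the linear bounds: its cells are \<open>-1/2\<close> and \<open>1/2\<close>.\<close>

lemma grid_term_domino:
  assumes "i \<ge> 1"
  shows "0 \<le> grid_term i (2 * k + 1) + grid_term i (2 * k + 2)"
proof (cases "i = 1 \<and> k = 0")
  case True
  then show ?thesis by (simp add: grid_term_def rank_bound_def even_recip_def)
next
  case False
  have r: "3 / (2 * (real (i + (2 * k + 1)) + 1)) \<le> recip (rank_bound i + rank_bound (2 * k + 1))"
    "3 / (2 * (real (i + (2 * k + 2)) + 1)) \<le> recip (rank_bound i + rank_bound (2 * k + 2))"
    using assms by (intro recip_rank_bound_ge; simp)+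
  show ?thesis
  proof (cases "even i")
    case True
    define s where "s = real (i + (2 * k + 2))"
    have s: "s \<ge> 3" using assms by (simp add: s_def)
    have "3 / (2 * s) + 3 / (2 * (s + 1)) - 2 / s = (2 * s - 1) / (2 * s * (s + 1))"
      using s by (simp add: divide_simps) (simp add: algebra_simps)
    also have "\<dots> \<ge> 0"
      using s by simp
    finally have "2 / s \<le> 3 / (2 * s) + 3 / (2 * (s + 1))"
      by simp
    with r True show ?thesis
      by (simp add: grid_term_def even_recip_def s_def algebra_simps)
  next
    case False': False
    define s where "s = real (i + (2 * k + 1))"
    have "i + (2 * k + 1) \<ge> 4"
      using False False' assms by presburger
    then have s: "s \<ge> 4" by (simp add: s_def)
    have "3 / (2 * (s + 1)) + 3 / (2 * (s + 2)) - 2 / s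
      = ((s - 4) * (2 * s + 5) + 12) / (2 * s * (s + 1) * (s + 2))"
      using s by (simp add: divide_simps) (simp add: algebra_simps)
    also have "\<dots> \<ge> 0"
      using s by (intro divide_nonneg_nonneg add_nonneg_nonneg mult_nonneg_nonneg) auto
    finally have "2 / s \<le> 3 / (2 * (s + 1)) + 3 / (2 * (s + 2))"
      by simp
    with r False' show ?thesis
      by (simp add: grid_term_def even_recip_def s_def algebra_simps)
  qed
qed

lemma grid_term_row_nonneg:
  assumes "i \<ge> 1" "even b"
  shows "0 \<le> (\<Sum>k = 1..b. grid_term i k)"
proof -
  have "0 \<le> (\<Sum>k = 1..2 * c. grid_term i k)" for c
  proof (induction c)
    case (Suc c)
    then show ?case
      using grid_term_domino[OF assms(1), of c] by (simp add: algebra_simps)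
  qed simp
  with assms(2) show ?thesis by (auto elim: evenE)
qed

text \<open>No row is negative, and row 2 gives \<open>1/2\<close> already from its first domino,
  where \<open>grid_term 2 1 = 1/2\<close> and \<open>grid_term 2 2 = 0\<close>.\<close>

lemma grid_sum_even_ge:
  assumes "a \<ge> 2" "b \<ge> 2" "even b"
  shows "1 / 2 \<le> (\<Sum>i = 1..a. \<Sum>k = 1..b. grid_term i k)"
proof -
  have "1 / 2 \<le> (\<Sum>k = 1..b. grid_term 2 k)"
  proof -
    have "1 / 2 \<le> (\<Sum>k = 1..2 * Suc c. grid_term 2 k)" for c
    proof (induction c)
      case 0
      have "{1..2 * Suc 0} = {1, 2}" by auto
      then show ?case by (simp add: grid_term_def rank_bound_def even_recip_def)
    next
      case (Suc c)
      then show ?case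
        using grid_term_domino[of 2 "Suc c"] by (simp add: algebra_simps)
    qed
    moreover obtain c where "b = 2 * Suc c"
      using assms by (metis dvdE not0_implies_Suc mult_0_right not_numeral_le_zero)
    ultimately show ?thesis by blast
  qed
  also have "\<dots> \<le> (\<Sum>i = 1..a. \<Sum>k = 1..b. grid_term i k)"
    using assms by (intro member_le_sum grid_term_row_nonneg) auto
  finally show ?thesis .
qed

text \<open>If \<open>b\<close> is odd, the last column is split off and read as row
  \<open>b\<close> by symmetry. If \<open>a\<close> is odd too, one cell of that row is left over;
  it is at least \<open>-1/3\<close> as \<open>a + b \<ge> 6\<close>, while the other columns give
  \<open>1/2\<close>.\<close>

lemma grid_sum_pos:
  assumes "a \<ge> 2" "b \<ge> 2"
  shows "0 < (\<Sum>i = 1..a. \<Sum>k = 1..b. grid_term i k)"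
proof (cases "even b")
  case True
  then show ?thesis using grid_sum_even_ge[OF assms] by linarith
next
  case False
  then obtain c where b: "b = Suc c" "even c" "c \<ge> 2"
    using assms by (cases b) auto
  have "-1 / 3 \<le> (\<Sum>i = 1..a. grid_term b i)"
  proof (cases "even a")
    case True
    then show ?thesis using grid_term_row_nonneg[of b a] assms by simp
  next
    case False': False
    then obtain e where a: "a = Suc e" "even e" "e \<ge> 2"
      using assms by (cases a) auto
    have "2 / real (a + b) \<le> 2 / 6"
      using a b by (intro divide_left_mono) auto
    then have "even_recip (b + a) \<le> 1 / 3"
      by (simp add: even_recip_def add.commute)
    moreover have "0 \<le> recip (rank_bound b + rank_bound a)"
      by simp
    ultimately have "-1 / 3 \<le> grid_term b a"
      unfolding grid_term_def by linarith
    then show ?thesis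
      using grid_term_row_nonneg[of b e] a b by simp
  qed
  then have "-1 / 3 \<le> (\<Sum>i = 1..a. grid_term i b)"
    by (simp add: grid_term_commute)
  moreover have "1 / 2 \<le> (\<Sum>i = 1..a. \<Sum>k = 1..c. grid_term i k)"
    using assms b by (intro grid_sum_even_ge)
  ultimately show ?thesis
    unfolding b by (simp add: sum.distrib)
qed

text \<open>The positive grid sum says that the cross reciprocals, even at the largest distances
  \<open>rank_bound\<close> allows, exceed half the growth of \<open>cycle_sum recip\<close> under
  gluing.\<close>

lemma cycle_sum_recip_subadditive:
  assumes "a \<ge> 2" "b \<ge> 2"
  shows "cycle_sum recip (a + b + 1) < cycle_sum recip (a + 1) + cycle_sum recip (b + 1)
    + 2 * (\<Sum>i = 1..a. \<Sum>k = 1..b. recip (rank_bound i + rank_bound k))"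
  using grid_sum_pos[OF assms] cycle_sum_recip_grid[of a b]
  by (simp add: grid_term_def sum_subtractf)

section \<open>Distances and levels\<close>

text \<open>Sorting \<open>A\<close> by \<open>d\<close> turns counts of the vertices before a level
  into bounds on the distance of the \<open>i\<close>-th vertex, which can be compared term by term
  with the cycle.\<close>

lemma rank_enumeration:
  fixes d :: "'a \<Rightarrow> nat"
  assumes "finite A"
  obtains \<sigma> where "bij_betw \<sigma> {1..card A} A"
    and "\<And>i. i \<in> {1..card A} \<Longrightarrow> card {y \<in> A. d y < d (\<sigma> i)} < i"
    and "\<And>i. i \<in> {1..card A} \<Longrightarrow> i \<le> card {y \<in> A. d y \<le> d (\<sigma> i)}"
proof -
  obtain ys where ys: "set ys = A" "distinct ys"
    using finite_distinct_list[OF assms] by blast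
  define xs where "xs = sort_key d ys"
  have xs: "set xs = A" "distinct xs" "sorted (map d xs)" "length xs = card A"
    using ys distinct_card[of ys] by (simp_all add: xs_def)
  have mono: "d (xs ! i) \<le> d (xs ! j)" if "i \<le> j" "j < length xs" for i j
    using sorted_nth_mono[OF xs(3), of i j] that by simp
  have inj: "inj_on (\<lambda>i. xs ! i) {..<length xs}"
    using xs(2) by (auto simp: inj_on_def nth_eq_iff_index_eq)
  \<comment> \<open>Ranks start at 1, list positions at 0.\<close>
  have "bij_betw (\<lambda>i. i - 1) {1..card A} {..<length xs}"
    by (rule bij_betw_byWitness[where f' = Suc]) (use xs(4) in auto)
  moreover have "bij_betw (\<lambda>i. xs ! i) {..<length xs} A"
    using bij_betw_nth[OF xs(2) refl] xs(1) by simp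
  ultimately have bij: "bij_betw (\<lambda>i. xs ! (i - 1)) {1..card A} A"
    using bij_betw_trans by (fastforce simp: comp_def)
  have less: "card {y \<in> A. d y < d (xs ! (i - 1))} < i" if i: "i \<in> {1..card A}" for i
  proof -
    have "{y \<in> A. d y < d (xs ! (i - 1))} \<subseteq> (\<lambda>j. xs ! j) ` {..<i - 1}"
    proof
      fix y assume y: "y \<in> {y \<in> A. d y < d (xs ! (i - 1))}"
      then obtain j where "j < length xs" "y = xs ! j"
        using xs(1) by (auto simp: in_set_conv_nth)
      moreover from this have "j < i - 1"
        using mono[of "i - 1" j] y by (force simp: not_less[symmetric])
      ultimately show "y \<in> (\<lambda>j. xs ! j) ` {..<i - 1}" by auto
    qed
    then have "card {y \<in> A. d y < d (xs ! (i - 1))} \<le> i - 1"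
      using surj_card_le[of "{..<i - 1}"] by simp
    with i show ?thesis by auto
  qed
  have le: "i \<le> card {y \<in> A. d y \<le> d (xs ! (i - 1))}" if i: "i \<in> {1..card A}" for i
  proof -
    have "(\<lambda>j. xs ! j) ` {..<i} \<subseteq> {y \<in> A. d y \<le> d (xs ! (i - 1))}"
      using mono[of _ "i - 1"] i xs by (auto simp: subset_iff Suc_le_eq[symmetric]) 
    moreover have "inj_on (\<lambda>j. xs ! j) {..<i}"
      using inj i xs(4) by (auto intro: inj_on_subset)
    then have "card ((\<lambda>j. xs ! j) ` {..<i}) = i"
      by (simp add: card_image)
    ultimately show ?thesis
      using card_mono[of "{y \<in> A. d y \<le> d (xs ! (i - 1))}" "(\<lambda>j. xs ! j) ` {..<i}"] assms by simp
  qed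
  show ?thesis
    using that bij less le by blast
qed

section \<open>Shortest walk lengths in a relation\<close>

definition walk_dist :: "'a rel \<Rightarrow> 'a \<Rightarrow> 'a \<Rightarrow> nat" where
  "walk_dist E u v = (LEAST k. (u, v) \<in> E ^^ k)"

lemma walk_dist_le: "(u, v) \<in> E ^^ k \<Longrightarrow> walk_dist E u v \<le> k"
  unfolding walk_dist_def by (rule Least_le)

lemma relpow_walk_dist: "(u, v) \<in> E\<^sup>* \<Longrightarrow> (u, v) \<in> E ^^ walk_dist E u v"
  unfolding walk_dist_def by (auto simp: rtrancl_power intro: LeastI)

lemma walk_dist_self [simp]: "walk_dist E u u = 0"
  using walk_dist_le[of u u 0 E] by simp

lemma walk_dist_eq_0_iff: "(u, v) \<in> E\<^sup>* \<Longrightarrow> walk_dist E u v = 0 \<longleftrightarrow> u = v"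
  using relpow_walk_dist[of u v E] by auto

lemma walk_dist_triangle:
  "(u, v) \<in> E\<^sup>* \<Longrightarrow> (v, w) \<in> E\<^sup>* \<Longrightarrow> walk_dist E u w \<le> walk_dist E u v + walk_dist E v w"
  by (intro walk_dist_le) (auto simp: relpow_add intro!: relcompI relpow_walk_dist)

lemma relpow_subset: "E \<subseteq> F \<Longrightarrow> E ^^ k \<subseteq> F ^^ k" for E F :: "'a rel"
  by (induction k) auto

lemma walk_dist_antimono: "E \<subseteq> F \<Longrightarrow> (u, v) \<in> E\<^sup>* \<Longrightarrow> walk_dist F u v \<le> walk_dist E u v"
  using relpow_walk_dist[of u v E] relpow_subset[of E F] by (blast intro: walk_dist_le)

lemma walk_dist_edge: "(u, v) \<in> E \<Longrightarrow> walk_dist E u v \<le> 1"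
  by (intro walk_dist_le) simp

lemma walk_dist_commute:
  assumes "sym E"
  shows "walk_dist E u v = walk_dist E v u"
proof -
  have "(v, u) \<in> E ^^ k" if "(u, v) \<in> E ^^ k" for u v k
    using that
  proof (induction k arbitrary: v)
    case (Suc k)
    then obtain w where "(u, w) \<in> E ^^ k" "(w, v) \<in> E" by auto
    then show ?case
      using Suc.IH symD[OF assms] by (blast intro: relpow_Suc_I2)
  qed simp
  then have "(u, v) \<in> E ^^ k \<longleftrightarrow> (v, u) \<in> E ^^ k" for k
    by blast
  then show ?thesis by (simp add: walk_dist_def)
qed

lemma walk_dist_predecessor:
  assumes "(u, w) \<in> E\<^sup>*" "walk_dist E u w = Suc k"
  obtains v where "(v, w) \<in> E" "walk_dist E u v = k"
proof -
  obtain v where v: "(u, v) \<in> E ^^ k" "(v, w) \<in> E"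
    using relpow_walk_dist[OF assms(1)] assms(2) by auto
  then have "(u, v) \<in> E\<^sup>*"
    by (auto simp: rtrancl_power)
  then have "Suc k \<le> walk_dist E u v + 1"
    using walk_dist_triangle[of u v E w] walk_dist_edge[OF v(2)] v(2) assms(2) by fastforce
  with walk_dist_le[OF v(1)] have "walk_dist E u v = k" by simp
  with v(2) that show ?thesis by blast
qed

lemma rtrancl_invariant:
  assumes "(x, y) \<in> R\<^sup>*" "x \<in> S" "\<And>u v. (u, v) \<in> R \<Longrightarrow> u \<in> S \<Longrightarrow> v \<in> S"
  shows "y \<in> S"
  using assms by (induction rule: rtrancl_induct) auto

text \<open>With a vertex set and a relation as parameters, the two sides of a cut vertex are again
  instances, obtained by restricting the relation.\<close>

locale conn_graph =
  fixes V :: "'a set" and E :: "'a rel"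
  assumes finite_V: "finite V"
    and E_subset: "E \<subseteq> V \<times> V"
    and sym_E: "sym E"
    and irrefl_E: "irrefl E"
    and conn: "u \<in> V \<Longrightarrow> v \<in> V \<Longrightarrow> (u, v) \<in> E\<^sup>*"
begin

abbreviation d :: "'a \<Rightarrow> 'a \<Rightarrow> nat" where
  "d \<equiv> walk_dist E"

definition level :: "'a \<Rightarrow> nat \<Rightarrow> 'a set" where
  "level c j = {y \<in> V. d c y = j}"

text \<open>The root is left out, so the cardinality is the number of ranks used up before level
  \<open>j\<close>.\<close>

definition closer :: "'a \<Rightarrow> nat \<Rightarrow> 'a set" where
  "closer c j = {y \<in> V - {c}. d c y < j}"

lemma finite_level [simp]: "finite (level c j)"
  using finite_V by (simp add: level_def)

lemma finite_closer [simp]: "finite (closer c j)"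
  using finite_V by (simp add: closer_def)

lemma E_in_V: "(u, v) \<in> E \<Longrightarrow> u \<in> V \<and> v \<in> V"
  using E_subset by auto

lemma d_edge_le: "c \<in> V \<Longrightarrow> (u, v) \<in> E \<Longrightarrow> d c v \<le> Suc (d c u)"
  using walk_dist_triangle[of c u E v] walk_dist_edge[of u v E] conn E_in_V by fastforce

lemma d_eq_0_iff: "u \<in> V \<Longrightarrow> v \<in> V \<Longrightarrow> d u v = 0 \<longleftrightarrow> u = v"
  using conn by (simp add: walk_dist_eq_0_iff)

lemma level_0: "c \<in> V \<Longrightarrow> level c 0 = {c}"
  by (auto simp: level_def d_eq_0_iff)

lemma level_1:
  assumes "c \<in> V"
  shows "level c 1 = E `` {c}"
proof
  show "level c 1 \<subseteq> E `` {c}"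
    using assms conn relpow_walk_dist[of c _ E] by (fastforce simp: level_def)
  show "E `` {c} \<subseteq> level c 1"
  proof
    fix y assume y: "y \<in> E `` {c}"
    then have "y \<in> V" "y \<noteq> c"
      using E_in_V irrefl_E by (auto simp: irrefl_def)
    then have "d c y \<noteq> 0" using assms d_eq_0_iff by auto
    with y \<open>y \<in> V\<close> show "y \<in> level c 1"
      using walk_dist_edge[of c y E] by (auto simp: level_def)
  qed
qed

lemma level_pred:
  assumes "c \<in> V" "y \<in> level c (Suc j)"
  obtains x where "x \<in> level c j" "(x, y) \<in> E"
  using assms walk_dist_predecessor[of c y E j] conn E_in_V by (auto simp: level_def)

lemma level_pred_nonempty: "c \<in> V \<Longrightarrow> level c (Suc j) \<noteq> {} \<Longrightarrow> level c j \<noteq> {}"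
  by (metis level_pred ex_in_conv)

lemma closer_Suc:
  assumes "c \<in> V" "j \<ge> 1"
  shows "card (closer c (Suc j)) = card (closer c j) + card (level c j)"
proof -
  have "closer c (Suc j) = closer c j \<union> level c j" "closer c j \<inter> level c j = {}"
    using assms by (auto simp: closer_def level_def)
  then show ?thesis
    by (simp add: card_Un_disjoint)
qed

lemma closer_1: "c \<in> V \<Longrightarrow> closer c 1 = {}"
  by (auto simp: closer_def d_eq_0_iff)

end

section \<open>Level sizes without bridges or cut vertices\<close>

definition bridgeless :: "'a rel \<Rightarrow> bool" where
  "bridgeless E \<longleftrightarrow> (\<forall>(x, y) \<in> E. (x, y) \<in> (E - {(x, y), (y, x)})\<^sup>*)"

definition vertex_deleted :: "'a rel \<Rightarrow> 'a \<Rightarrow> 'a rel" where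
  "vertex_deleted E c = E \<inter> (- {c}) \<times> (- {c})"

definition cut_vertex :: "'a set \<Rightarrow> 'a rel \<Rightarrow> 'a \<Rightarrow> bool" where
  "cut_vertex V E c \<longleftrightarrow> c \<in> V \<and> (\<exists>x \<in> V - {c}. \<exists>y \<in> V - {c}. (x, y) \<notin> (vertex_deleted E c)\<^sup>*)"

context conn_graph
begin

text \<open>Two singleton levels would be joined by a single edge. As an edge raises the distance
  from \<open>c\<close> by at most one, every walk from distance at most \<open>j\<close> to beyond
  would use it, so it would be a bridge.\<close>

lemma bridgeless_levels:
  assumes "bridgeless E" "c \<in> V" "level c (Suc j) \<noteq> {}"
  shows "3 \<le> card (level c j) + card (level c (Suc j))"
proof (rule ccontr)
  assume "\<not> ?thesis"
  moreover have "card (level c j) > 0" "card (level c (Suc j)) > 0"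
    using assms level_pred_nonempty by (simp_all add: card_gt_0_iff)
  ultimately have "card (level c j) = 1" "card (level c (Suc j)) = 1"
    by linarith+
  then obtain x y where xy: "level c j = {x}" "level c (Suc j) = {y}"
    by (auto simp: card_1_singleton_iff)
  then have "(x, y) \<in> E"
    using level_pred[OF assms(2), of y j] by auto
  then have "(x, y) \<in> (E - {(x, y), (y, x)})\<^sup>*"
    using assms(1) by (auto simp: bridgeless_def)
  then have "y \<in> {z \<in> V. d c z \<le> j}"
  proof (rule rtrancl_invariant)
    show "x \<in> {z \<in> V. d c z \<le> j}"
      using xy(1) by (auto simp: level_def)
    fix u v assume uv: "(u, v) \<in> E - {(x, y), (y, x)}" "u \<in> {z \<in> V. d c z \<le> j}"
    show "v \<in> {z \<in> V. d c z \<le> j}"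
    proof (rule ccontr)
      assume "v \<notin> {z \<in> V. d c z \<le> j}"
      then have "d c u = j" "d c v = Suc j"
        using uv d_edge_le[OF assms(2), of u v] E_in_V by force+
      then have "u \<in> level c j" "v \<in> level c (Suc j)"
        using uv E_in_V by (auto simp: level_def)
      with xy uv show False by auto
    qed
  qed
  with xy show False by (auto simp: level_def)
qed

text \<open>Walks from \<open>c\<close> to level \<open>Suc j\<close> pass through level
  \<open>j\<close>. A single vertex there differs from \<open>c\<close> because
  \<open>j \<ge> 1\<close>, so it would be a cut vertex.\<close>

lemma noncut_level:
  assumes "\<And>x. \<not> cut_vertex V E x" "c \<in> V" "j \<ge> 1" "level c (Suc j) \<noteq> {}"
  shows "2 \<le> card (level c j)"
proof (rule ccontr)
  assume "\<not> ?thesis"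
  moreover have "card (level c j) > 0"
    using assms level_pred_nonempty by (simp_all add: card_gt_0_iff)
  ultimately have "card (level c j) = 1"
    by linarith
  then obtain x where x: "level c j = {x}"
    by (auto simp: card_1_singleton_iff)
  obtain y where y: "y \<in> level c (Suc j)"
    using assms(4) by auto
  have "x \<in> V" "d c x = j"
    using x by (auto simp: level_def)
  then have "x \<noteq> c" "x \<noteq> y"
    using assms(3) y by (auto simp: level_def)
  then have "(c, y) \<in> (vertex_deleted E x)\<^sup>*"
    using assms(1)[of x] assms(2) \<open>x \<in> V\<close> y by (auto simp: cut_vertex_def level_def)
  then have "y \<in> {z. d c z < j}"
  proof (rule rtrancl_invariant)
    show "c \<in> {z. d c z < j}" using assms by simp
    fix u v assume uv: "(u, v) \<in> vertex_deleted E x" "u \<in> {z. d c z < j}"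
    then have "(u, v) \<in> E" "v \<noteq> x" by (auto simp: vertex_deleted_def)
    then have "d c v \<le> j" "v \<in> V" "d c v \<noteq> j"
      using uv d_edge_le[OF assms(2), of u v] E_in_V x by (auto simp: level_def)
    then show "v \<in> {z. d c z < j}" by simp
  qed
  with y show False by (auto simp: level_def)
qed

text \<open>From \<open>j\<close> to \<open>Suc j\<close> the right-hand side grows by the sizes of
  these two levels, at least 3 together. The weights 2 for closer and 1 for equally distant vertices
  make the sum over all vertices symmetric in \<open>bridgeless_transmission_le\<close>.\<close>

lemma bridgeless_level_bound:
  assumes "bridgeless E" "c \<in> V" "j \<ge> 1" "level c j \<noteq> {}"
  shows "3 * j \<le> 1 + 2 * card (closer c j) + card (level c j)"
  using assms(3,4)
proof (induction j rule: dec_induct)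
  case base
  then show ?case
    using bridgeless_levels[OF assms(1,2), of 0] level_0[OF assms(2)] by simp
next
  case (step j)
  then have "level c j \<noteq> {}"
    using level_pred_nonempty[OF assms(2)] by blast
  with step show ?case
    using bridgeless_levels[OF assms(1,2), of j] closer_Suc[OF assms(2), of j] by simp
qed

text \<open>The previous bound one level down: level \<open>j - 1\<close> is nonempty, so raising
  its weight from 1 to 2 absorbs the constant 1. With fewer than \<open>i\<close> closer vertices
  this yields \<open>rank_bound i\<close>.\<close>

lemma bridgeless_closer_bound:
  assumes "bridgeless E" "c \<in> V" "j \<ge> 1" "level c j \<noteq> {}"
  shows "3 * j \<le> 3 + 2 * card (closer c j)"
proof (cases "j = 1")
  case False
  then obtain k where k: "j = Suc k" "k \<ge> 1"
    using assms(3) by (cases j) auto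
  have ne: "level c k \<noteq> {}"
    using level_pred_nonempty assms(2,4) k(1) by blast
  then have "card (level c k) \<ge> 1"
    by (simp add: Suc_le_eq card_gt_0_iff)
  then show ?thesis
    using bridgeless_level_bound[OF assms(1,2) k(2) ne] closer_Suc[OF assms(2) k(2)] k(1) by simp
qed simp

text \<open>Each of the levels 1 to \<open>j - 1\<close> contributes at least two vertices by
  \<open>noncut_level\<close>.\<close>

lemma noncut_closer_bound:
  assumes "\<And>x. \<not> cut_vertex V E x" "c \<in> V" "j \<ge> 1" "level c j \<noteq> {}"
  shows "2 * (j - 1) \<le> card (closer c j)"
  using assms(3,4)
proof (induction j rule: dec_induct)
  case (step j)
  then have "level c j \<noteq> {}"
    using level_pred_nonempty[OF assms(2)] by blast
  with step show ?case
    using noncut_level[OF assms(1,2), of j] closer_Suc[OF assms(2), of j] by simp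
qed simp

text \<open>A vertex other than the root has one of its two neighbours in the previous level, hence
  at most one in the next. So levels never grow beyond the two vertices of level 1.\<close>

lemma two_regular_closer_bound:
  assumes "\<And>v. v \<in> V \<Longrightarrow> card (E `` {v}) = 2" "c \<in> V"
  shows "card (closer c (Suc j)) \<le> 2 * j"
proof -
  have fin: "finite (E `` {v})" for v
    using finite_V E_subset by (auto intro: finite_subset[of _ V])
  have level: "card (level c (Suc j)) \<le> 2" for j
  proof (induction j)
    case 0
    then show ?case using assms level_1[of c] by simp
  next
    case (Suc j)
    define next_nbrs where "next_nbrs x = E `` {x} \<inter> level c (Suc (Suc j))" for x
    have "level c (Suc (Suc j)) \<subseteq> (\<Union>x \<in> level c (Suc j). next_nbrs x)"
    proof
      fix y assume y: "y \<in> level c (Suc (Suc j))"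
      then obtain x where "x \<in> level c (Suc j)" "(x, y) \<in> E"
        using level_pred[OF assms(2)] by blast
      with y show "y \<in> (\<Union>x \<in> level c (Suc j). next_nbrs x)"
        by (auto simp: next_nbrs_def)
    qed
    then have "card (level c (Suc (Suc j))) \<le> card (\<Union>x \<in> level c (Suc j). next_nbrs x)"
      using fin by (intro card_mono) (auto simp: next_nbrs_def)
    also have "\<dots> \<le> (\<Sum>x \<in> level c (Suc j). card (next_nbrs x))"
      by (intro card_UN_le) simp
    also have "\<dots> \<le> (\<Sum>x \<in> level c (Suc j). 1)"
    proof (rule sum_mono)
      fix x assume x: "x \<in> level c (Suc j)"
      obtain w where w: "w \<in> level c j" "(w, x) \<in> E"
        using level_pred[OF assms(2) x] by blast
      then have "w \<in> E `` {x}" "w \<notin> next_nbrs x"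
        using symD[OF sym_E] by (auto simp: next_nbrs_def level_def)
      then have "next_nbrs x \<subset> E `` {x}"
        by (auto simp: next_nbrs_def)
      then have "card (next_nbrs x) < card (E `` {x})"
        using fin by (intro psubset_card_mono)
      then show "card (next_nbrs x) \<le> 1"
        using assms(1)[of x] x by (simp add: level_def)
    qed
    finally show ?case using Suc by simp
  qed
  show ?thesis
  proof (induction j)
    case 0
    then show ?case using closer_1[OF assms(2)] by simp
  next
    case (Suc j)
    then show ?case
      using closer_Suc[OF assms(2), of "Suc j"] level[of j] by simp
  qed
qed

end

section \<open>Distance sums of bridgeless graphs\<close>

text \<open>Ordered pairs, as in \<open>cycle_sum\<close>, so that the sum splits into one full row
  per vertex.\<close>

definition dist_sum :: "(nat \<Rightarrow> real) \<Rightarrow> 'a set \<Rightarrow> 'a rel \<Rightarrow> real" where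
  "dist_sum \<phi> V E = (\<Sum>u \<in> V. \<Sum>v \<in> V - {u}. \<phi> (walk_dist E u v))"

context conn_graph
begin

lemma d_ge_1: "u \<in> V \<Longrightarrow> v \<in> V - {u} \<Longrightarrow> 1 \<le> d u v"
  using d_eq_0_iff[of u v] by (auto simp: Suc_le_eq)

lemma distance_enumeration:
  assumes "c \<in> V"
  obtains \<sigma> where "bij_betw \<sigma> {1..card V - 1} (V - {c})"
    and "\<forall>i \<in> {1..card V - 1}. card (closer c (d c (\<sigma> i))) < i"
    and "\<forall>i \<in> {1..card V - 1}. i \<le> card (closer c (Suc (d c (\<sigma> i))))"
proof (rule rank_enumeration[of "V - {c}" "d c"])
  show "finite (V - {c})" using finite_V by simp
  have "card (V - {c}) = card V - 1"
    using assms finite_V by simp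
  moreover fix \<sigma> assume "bij_betw \<sigma> {1..card (V - {c})} (V - {c})"
    and "\<And>i. i \<in> {1..card (V - {c})} \<Longrightarrow> card {y \<in> V - {c}. d c y < d c (\<sigma> i)} < i"
    and "\<And>i. i \<in> {1..card (V - {c})} \<Longrightarrow> i \<le> card {y \<in> V - {c}. d c y \<le> d c (\<sigma> i)}"
  ultimately show thesis
    by (intro that[of \<sigma>]) (simp_all add: closer_def less_Suc_eq_le)
qed

text \<open>By \<open>noncut_closer_bound\<close> the \<open>i\<close>-th closest vertex is no
  farther than in the cycle. A third neighbour makes rank 3 strictly better: distance 1 instead of
  2.\<close>

lemma noncut_row_le:
  fixes \<phi> :: "nat \<Rightarrow> real"
  assumes mono: "\<And>i j. 1 \<le> i \<Longrightarrow> i < j \<Longrightarrow> \<phi> i < \<phi> j"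
    and noncut: "\<And>x. \<not> cut_vertex V E x" and c: "c \<in> V"
  shows "(\<Sum>y \<in> V - {c}. \<phi> (d c y)) \<le> (\<Sum>i = 1..card V - 1. \<phi> ((i + 1) div 2))"
    and "card (E `` {c}) \<ge> 3 \<Longrightarrow>
      (\<Sum>y \<in> V - {c}. \<phi> (d c y)) < (\<Sum>i = 1..card V - 1. \<phi> ((i + 1) div 2))"
proof -
  have card: "card (V - {c}) = card V - 1"
    using c finite_V by simp
  obtain \<sigma> where bij: "bij_betw \<sigma> {1..card V - 1} (V - {c})"
    and lt: "\<forall>i \<in> {1..card V - 1}. card (closer c (d c (\<sigma> i))) < i"
    and "\<forall>i \<in> {1..card V - 1}. i \<le> card (closer c (Suc (d c (\<sigma> i))))"
    by (rule distance_enumeration[OF c])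
  have in_V: "\<sigma> i \<in> V - {c}" if "i \<in> {1..card V - 1}" for i
    using bij that by (auto simp: bij_betw_def)
  have d1: "1 \<le> d c (\<sigma> i)" if "i \<in> {1..card V - 1}" for i
    using d_ge_1[OF c in_V[OF that]] .
  have le: "d c (\<sigma> i) \<le> (i + 1) div 2" if i: "i \<in> {1..card V - 1}" for i
  proof -
    have "level c (d c (\<sigma> i)) \<noteq> {}"
      using in_V[OF i] by (auto simp: level_def)
    then have "2 * (d c (\<sigma> i) - 1) \<le> card (closer c (d c (\<sigma> i)))"
      using noncut_closer_bound[OF noncut c d1[OF i]] by blast
    with bspec[OF lt i] show ?thesis by linarith
  qed
  have \<phi>_le: "\<phi> i \<le> \<phi> j" if "1 \<le> i" "i \<le> j" for i j
    using mono[of i j] that by (cases "i = j") auto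
  have eq: "(\<Sum>y \<in> V - {c}. \<phi> (d c y)) = (\<Sum>i = 1..card V - 1. \<phi> (d c (\<sigma> i)))"
    using sum.reindex_bij_betw[OF bij, of "\<lambda>y. \<phi> (d c y)"] by simp
  show "(\<Sum>y \<in> V - {c}. \<phi> (d c y)) \<le> (\<Sum>i = 1..card V - 1. \<phi> ((i + 1) div 2))"
    unfolding eq using d1 le by (intro sum_mono \<phi>_le)
  show "(\<Sum>y \<in> V - {c}. \<phi> (d c y)) < (\<Sum>i = 1..card V - 1. \<phi> ((i + 1) div 2))"
    if deg: "card (E `` {c}) \<ge> 3"
    unfolding eq
  proof (rule sum_strict_mono_ex1)
    have "level c 1 \<subseteq> V - {c}"
      by (auto simp: level_def)
    then have "card (level c 1) \<le> card V - 1"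
      using card_mono[of "V - {c}"] finite_V card by simp
    then have 3: "3 \<in> {1..card V - 1}"
      using deg level_1[OF c] by simp
    \<comment> \<open>Otherwise at least three neighbours of \<open>c\<close> would be closer than
      the vertex of rank 3.\<close>
    have "d c (\<sigma> 3) < 2"
    proof (rule ccontr)
      assume "\<not> d c (\<sigma> 3) < 2"
      then have "level c 1 \<subseteq> closer c (d c (\<sigma> 3))"
        by (auto simp: level_def closer_def)
      then have "card (level c 1) \<le> card (closer c (d c (\<sigma> 3)))"
        by (intro card_mono) auto
      then show False
        using bspec[OF lt 3] deg level_1[OF c] by simp
    qed
    then have "\<phi> (d c (\<sigma> 3)) < \<phi> ((3 + 1) div 2)"
      using d1[OF 3] by (intro mono) auto
    with 3 show "\<exists>i \<in> {1..card V - 1}. \<phi> (d c (\<sigma> i)) < \<phi> ((i + 1) div 2)"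
      by blast
  qed (use d1 le in \<open>auto intro!: \<phi>_le\<close>)
qed

text \<open>At least \<open>i\<close> vertices are as close as the \<open>i\<close>-th one, but
  \<open>two_regular_closer_bound\<close> allows only twice its distance.\<close>

lemma two_regular_row_ge:
  fixes \<phi> :: "nat \<Rightarrow> real"
  assumes mono: "\<And>i j. 1 \<le> i \<Longrightarrow> i < j \<Longrightarrow> \<phi> i < \<phi> j"
    and reg: "\<And>v. v \<in> V \<Longrightarrow> card (E `` {v}) = 2" and c: "c \<in> V"
  shows "(\<Sum>i = 1..card V - 1. \<phi> ((i + 1) div 2)) \<le> (\<Sum>y \<in> V - {c}. \<phi> (d c y))"
proof -
  obtain \<sigma> where bij: "bij_betw \<sigma> {1..card V - 1} (V - {c})"
    and "\<forall>i \<in> {1..card V - 1}. card (closer c (d c (\<sigma> i))) < i"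
    and le: "\<forall>i \<in> {1..card V - 1}. i \<le> card (closer c (Suc (d c (\<sigma> i))))"
    by (rule distance_enumeration[OF c])
  have \<phi>_le: "\<phi> i \<le> \<phi> j" if "1 \<le> i" "i \<le> j" for i j
    using mono[of i j] that by (cases "i = j") auto
  have "(\<Sum>i = 1..card V - 1. \<phi> ((i + 1) div 2)) \<le> (\<Sum>i = 1..card V - 1. \<phi> (d c (\<sigma> i)))"
  proof (intro sum_mono \<phi>_le)
    fix i assume i: "i \<in> {1..card V - 1}"
    then show "1 \<le> (i + 1) div 2" by auto
    show "(i + 1) div 2 \<le> d c (\<sigma> i)"
      using bspec[OF le i] two_regular_closer_bound[OF reg c, of "d c (\<sigma> i)"] by linarith
  qed
  also have "\<dots> = (\<Sum>y \<in> V - {c}. \<phi> (d c y))"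
    using sum.reindex_bij_betw[OF bij, of "\<lambda>y. \<phi> (d c y)"] by simp
  finally show ?thesis .
qed

text \<open>Cut vertices are allowed, since the parts of a split may have further ones.
  \<open>\<phi>\<close> may be a whole inner sum, which is how both parts are treated in
  turn.\<close>

lemma bridgeless_row_le:
  fixes \<phi> :: "nat \<Rightarrow> real"
  assumes mono: "\<And>i j. 1 \<le> i \<Longrightarrow> i \<le> j \<Longrightarrow> \<phi> i \<le> \<phi> j"
    and bridgeless: "bridgeless E" and c: "c \<in> V"
  shows "(\<Sum>y \<in> V - {c}. \<phi> (d c y)) \<le> (\<Sum>i = 1..card V - 1. \<phi> (rank_bound i))"
proof -
  obtain \<sigma> where bij: "bij_betw \<sigma> {1..card V - 1} (V - {c})"
    and lt: "\<forall>i \<in> {1..card V - 1}. card (closer c (d c (\<sigma> i))) < i"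
    and "\<forall>i \<in> {1..card V - 1}. i \<le> card (closer c (Suc (d c (\<sigma> i))))"
    by (rule distance_enumeration[OF c])
  have "(\<Sum>y \<in> V - {c}. \<phi> (d c y)) = (\<Sum>i = 1..card V - 1. \<phi> (d c (\<sigma> i)))"
    using sum.reindex_bij_betw[OF bij, of "\<lambda>y. \<phi> (d c y)"] by simp
  also have "\<dots> \<le> (\<Sum>i = 1..card V - 1. \<phi> (rank_bound i))"
  proof (intro sum_mono mono)
    fix i assume i: "i \<in> {1..card V - 1}"
    then have in_V: "\<sigma> i \<in> V - {c}"
      using bij by (auto simp: bij_betw_def)
    show d1: "1 \<le> d c (\<sigma> i)"
      using d_ge_1[OF c in_V] .
    have "level c (d c (\<sigma> i)) \<noteq> {}"
      using in_V by (auto simp: level_def)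
    then have "3 * d c (\<sigma> i) \<le> 3 + 2 * card (closer c (d c (\<sigma> i)))"
      using bridgeless_closer_bound[OF bridgeless c d1] by blast
    then show "d c (\<sigma> i) \<le> rank_bound i"
      using bspec[OF lt i] unfolding rank_bound_def by linarith
  qed
  finally show ?thesis .
qed

text \<open>
  Summing \<open>3 d(y) \<le> 1 + 2 |{z. d(z) < d(y)}| + |{z. d(z) = d(y)}|\<close> over \<open>y\<close>: by symmetry every ordered
  pair \<open>(y, z)\<close> is counted exactly once.
\<close>

lemma bridgeless_transmission_le:
  assumes "bridgeless E" and c: "c \<in> V" and n: "card V = n + 1"
  shows "3 * (\<Sum>y \<in> V - {c}. real (d c y)) \<le> real (n\<^sup>2 + n)"
proof -
  let ?A = "V - {c}"
  have A: "finite ?A" "card ?A = n"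
    using c n finite_V by simp_all
  define L where "L y z = (if d c z < d c y then 1 else 0 :: nat)" for y z
  define Q where "Q y z = (if d c z = d c y then 1 else 0 :: nat)" for y z
  have bound: "3 * d c y \<le> 1 + ((\<Sum>z \<in> ?A. L y z) + (\<Sum>z \<in> ?A. L y z) + (\<Sum>z \<in> ?A. Q y z))"
    if y: "y \<in> ?A" for y
  proof -
    have d1: "1 \<le> d c y" and ne: "level c (d c y) \<noteq> {}"
      using y d_ge_1[OF c] by (auto simp: level_def)
    have "level c (d c y) = {z \<in> ?A. d c z = d c y}"
      using d1 by (auto simp: level_def)
    then have "card (closer c (d c y)) = (\<Sum>z \<in> ?A. L y z)" "card (level c (d c y)) = (\<Sum>z \<in> ?A. Q y z)"
      using A by (simp_all add: closer_def L_def Q_def sum.If_cases Int_def)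
    then show ?thesis
      using bridgeless_level_bound[OF assms(1) c d1 ne] by simp
  qed
  have "3 * (\<Sum>y \<in> ?A. d c y) = (\<Sum>y \<in> ?A. 3 * d c y)"
    by (rule sum_distrib_left)
  also have "\<dots> \<le> (\<Sum>y \<in> ?A. 1 + ((\<Sum>z \<in> ?A. L y z) + (\<Sum>z \<in> ?A. L y z) + (\<Sum>z \<in> ?A. Q y z)))"
    using bound by (rule sum_mono)
  also have "\<dots> = n + ((\<Sum>y \<in> ?A. \<Sum>z \<in> ?A. L y z) + (\<Sum>y \<in> ?A. \<Sum>z \<in> ?A. L y z)
    + (\<Sum>y \<in> ?A. \<Sum>z \<in> ?A. Q y z))"
    using A by (simp only: sum.distrib) simp
  also have "(\<Sum>y \<in> ?A. \<Sum>z \<in> ?A. L y z) + (\<Sum>y \<in> ?A. \<Sum>z \<in> ?A. L y z) + (\<Sum>y \<in> ?A. \<Sum>z \<in> ?A. Q y z)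
    = (\<Sum>y \<in> ?A. \<Sum>z \<in> ?A. L y z) + (\<Sum>y \<in> ?A. \<Sum>z \<in> ?A. L z y) + (\<Sum>y \<in> ?A. \<Sum>z \<in> ?A. Q y z)"
    using sum.swap[of L ?A ?A] by simp
  also have "\<dots> = (\<Sum>y \<in> ?A. \<Sum>z \<in> ?A. L y z + L z y + Q y z)"
    by (simp only: sum.distrib)
  also have "\<dots> = (\<Sum>y \<in> ?A. \<Sum>z \<in> ?A. 1)"
    by (intro sum.cong refl) (auto simp: L_def Q_def)
  also have "\<dots> = n\<^sup>2"
    using A by (simp add: power2_eq_square)
  finally have "3 * (\<Sum>y \<in> ?A. d c y) \<le> n\<^sup>2 + n" by simp
  then have "real (3 * (\<Sum>y \<in> ?A. d c y)) \<le> real (n\<^sup>2 + n)"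
    unfolding of_nat_le_iff .
  then show ?thesis by simp
qed

text \<open>\<open>bridgeless_levels\<close> at the root: level 0 has one vertex, and level 1 is the
  neighbourhood.\<close>

lemma bridgeless_degree_ge_2:
  assumes "bridgeless E" "v \<in> V" "card V \<ge> 2"
  shows "card (E `` {v}) \<ge> 2"
proof -
  have "V \<noteq> {v}" using assms(3) by auto
  then obtain u where u: "u \<in> V" "u \<noteq> v" using assms(2) by auto
  then obtain w where "(v, w) \<in> E"
    using conn[OF assms(2) u(1)] by (metis converse_rtranclE)
  then have "level v (Suc 0) \<noteq> {}"
    using level_1[OF assms(2)] by auto
  then show ?thesis
    using bridgeless_levels[OF assms(1,2), of 0] level_0[OF assms(2)] level_1[OF assms(2)] by simp
qed

lemma bridgeless_card_ge_3:
  assumes "bridgeless E" "card V \<ge> 2"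
  shows "card V \<ge> 3"
proof -
  obtain v where v: "v \<in> V"
    using assms(2) by fastforce
  have "E `` {v} \<subseteq> V - {v}"
    using E_in_V irrefl_E by (auto simp: irrefl_def)
  then have "card (E `` {v}) \<le> card (V - {v})"
    using finite_V by (intro card_mono) auto
  then show ?thesis
    using bridgeless_degree_ge_2[OF assms(1) v assms(2)] v finite_V by simp
qed

section \<open>Splitting at a cut vertex\<close>

lemma cut_vertex_split:
  assumes "cut_vertex V E c"
  obtains S T where "S \<union> T = V" "S \<inter> T = {c}" "S \<noteq> {c}" "T \<noteq> {c}" "E \<subseteq> S \<times> S \<union> T \<times> T"
proof -
  obtain x y where xy: "c \<in> V" "x \<in> V - {c}" "y \<in> V - {c}" "(x, y) \<notin> (vertex_deleted E c)\<^sup>*"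
    using assms by (auto simp: cut_vertex_def)
  \<comment> \<open>The component of \<open>x\<close> once \<open>c\<close> is deleted. The parts
    are \<open>insert c A\<close> and \<open>V - A\<close>; the latter may contain several
    components.\<close>
  define A where "A = {z \<in> V - {c}. (x, z) \<in> (vertex_deleted E c)\<^sup>*}"
  have closed: "v \<in> A" if "(u, v) \<in> E" "u \<in> A" "v \<noteq> c" for u v
  proof -
    have "(u, v) \<in> vertex_deleted E c"
      using that by (auto simp: vertex_deleted_def A_def)
    with that show ?thesis
      using E_in_V by (auto simp: A_def intro: rtrancl_into_rtrancl)
  qed
  have "E \<subseteq> insert c A \<times> insert c A \<union> (V - A) \<times> (V - A)"
  proof (rule subrelI)
    fix u v assume uv: "(u, v) \<in> E"
    moreover have "(v, u) \<in> E" using uv sym_E by (auto dest: symD)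
    moreover have "c \<notin> A" by (auto simp: A_def)
    ultimately show "(u, v) \<in> insert c A \<times> insert c A \<union> (V - A) \<times> (V - A)"
      using closed[of u v] closed[of v u] E_in_V[of u v] xy(1) by blast
  qed
  moreover have "insert c A \<union> (V - A) = V" "insert c A \<inter> (V - A) = {c}"
    using xy(1) by (auto simp: A_def)
  moreover have "x \<in> A" "y \<in> V - A"
    using xy by (auto simp: A_def)
  then have "insert c A \<noteq> {c}" "V - A \<noteq> {c}"
    using xy by auto
  ultimately show ?thesis using that by blast
qed

text \<open>The other part is entered and left only through \<open>c\<close>, so detours into it can
  be cut out of walks. This is applied to \<open>E\<close> for connectivity and to \<open>E\<close>
  without one edge for bridgelessness.\<close>

lemma
  assumes "S \<union> T = V" "S \<inter> T = {c}" "E \<subseteq> S \<times> S \<union> T \<times> T"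
  shows conn_graph_part: "conn_graph S (E \<inter> S \<times> S)"
    and bridgeless_part: "bridgeless E \<Longrightarrow> bridgeless (E \<inter> S \<times> S)"
proof -
  \<comment> \<open>Collapsing \<open>T\<close> to \<open>c\<close> maps walks of \<open>E\<close> to walks inside \<open>S\<close>.\<close>
  define r where "r x = (if x \<in> S then x else c)" for x
  have retract: "(r u, r v) \<in> (F \<inter> S \<times> S)\<^sup>*" if "(u, v) \<in> F\<^sup>*" "F \<subseteq> E" for u v F
    using that(1)
  proof (induction rule: rtrancl_induct)
    case (step v w)
    have vw: "(v, w) \<in> S \<times> S \<union> T \<times> T"
      using step(2) that(2) assms(3) by blast
    have "(r v, r w) \<in> (F \<inter> S \<times> S)\<^sup>*"
    proof (cases "v \<in> S \<and> w \<in> S")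
      case True
      then show ?thesis using step(2) by (auto simp: r_def)
    next
      case False
      then have "v \<in> T" "w \<in> T" using vw by auto
      then have "r v = c" "r w = c" using assms(2) by (auto simp: r_def)
      then show ?thesis by simp
    qed
    with step(3) show ?case by (rule rtrancl_trans)
  qed simp
  show "conn_graph S (E \<inter> S \<times> S)"
  proof
    show "finite S" using finite_V assms(1) by auto
    show "sym (E \<inter> S \<times> S)" using sym_E by (auto simp: sym_def)
    show "irrefl (E \<inter> S \<times> S)" using irrefl_E by (auto simp: irrefl_def)
    fix u v assume uv: "u \<in> S" "v \<in> S"
    then have "(u, v) \<in> E\<^sup>*" using conn assms(1) by auto
    from retract[OF this order_refl] uv show "(u, v) \<in> (E \<inter> S \<times> S)\<^sup>*"
      by (simp add: r_def)
  qed auto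
  assume "bridgeless E"
  show "bridgeless (E \<inter> S \<times> S)"
    unfolding bridgeless_def
  proof clarify
    fix x y assume xy: "(x, y) \<in> E" "x \<in> S" "y \<in> S"
    then have "(x, y) \<in> (E - {(x, y), (y, x)})\<^sup>*"
      using \<open>bridgeless E\<close> by (auto simp: bridgeless_def)
    from retract[OF this] xy
    have "(x, y) \<in> ((E - {(x, y), (y, x)}) \<inter> S \<times> S)\<^sup>*"
      by (simp add: r_def)
    moreover have "(E - {(x, y), (y, x)}) \<inter> S \<times> S = E \<inter> S \<times> S - {(x, y), (y, x)}"
      by blast
    ultimately show "(x, y) \<in> (E \<inter> S \<times> S - {(x, y), (y, x)})\<^sup>*" by simp
  qed
qed

text \<open>Restricting to a part only removes walks, so distances inside it cannot shrink; a pair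
  across the parts is joined through \<open>c\<close>.\<close>

lemma dist_sum_split_le:
  fixes \<phi> :: "nat \<Rightarrow> real"
  assumes mono: "\<And>i j. 1 \<le> i \<Longrightarrow> i < j \<Longrightarrow> \<phi> i < \<phi> j"
    and split: "S \<union> T = V" "S \<inter> T = {c}" "E \<subseteq> S \<times> S \<union> T \<times> T"
  shows "dist_sum \<phi> V E \<le> dist_sum \<phi> S (E \<inter> S \<times> S) + dist_sum \<phi> T (E \<inter> T \<times> T)
    + 2 * (\<Sum>x \<in> S - {c}. \<Sum>y \<in> T - {c}.
        \<phi> (walk_dist (E \<inter> S \<times> S) c x + walk_dist (E \<inter> T \<times> T) c y))"
proof -
  interpret S: conn_graph S "E \<inter> S \<times> S"
    using split by (rule conn_graph_part)
  interpret T: conn_graph T "E \<inter> T \<times> T"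
    using split by (intro conn_graph_part[of T S c]) auto
  define A B where "A = S - {c}" and "B = T - {c}"
  have fin: "finite A" "finite B"
    using S.finite_V T.finite_V by (simp_all add: A_def B_def)
  have c: "c \<notin> A" "c \<notin> B" "A \<inter> B = {}" and S: "S = insert c A" and T: "T = insert c B"
    and V: "V = insert c (A \<union> B)"
    using split by (auto simp: A_def B_def)
  have \<phi>_le: "\<phi> i \<le> \<phi> j" if "1 \<le> i" "i \<le> j" for i j
    using mono[of i j] that by (cases "i = j") auto
  define g where "g F u v = (if v = u then 0 else \<phi> (walk_dist F u v))" for F :: "'a rel" and u v
  have dist_sum_g: "dist_sum \<phi> X F = (\<Sum>u \<in> X. \<Sum>v \<in> X. g F u v)" if "finite X" for X and F :: "'a rel"
    unfolding dist_sum_def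
  proof (rule sum.cong[OF refl])
    fix u assume "u \<in> X"
    have "(\<Sum>v \<in> X - {u}. \<phi> (walk_dist F u v)) = (\<Sum>v \<in> X - {u}. g F u v)"
      by (intro sum.cong) (auto simp: g_def)
    also have "\<dots> = (\<Sum>v \<in> X. g F u v)"
      using that by (intro sum.mono_neutral_left) (auto simp: g_def)
    finally show "(\<Sum>v \<in> X - {u}. \<phi> (walk_dist F u v)) = (\<Sum>v \<in> X. g F u v)" .
  qed
  have g_S: "g E u v \<le> g (E \<inter> S \<times> S) u v" if "u \<in> S" "v \<in> S" for u v
    using that S.conn[of u v] d_ge_1[of u v] V S
    by (auto simp: g_def intro!: \<phi>_le walk_dist_antimono)
  have g_T: "g E u v \<le> g (E \<inter> T \<times> T) u v" if "u \<in> T" "v \<in> T" for u v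
    using that T.conn[of u v] d_ge_1[of u v] V T
    by (auto simp: g_def intro!: \<phi>_le walk_dist_antimono)
  define h where "h x y = \<phi> (walk_dist (E \<inter> S \<times> S) c x + walk_dist (E \<inter> T \<times> T) c y)" for x y
  have cross: "g E x y \<le> h x y" if "x \<in> A" "y \<in> B" for x y
  proof -
    have "x \<noteq> y" using that c by auto
    have xy: "x \<in> V" "c \<in> V" "y \<in> V - {x}" using that V c by auto
    have "d x y \<le> d x c + d c y"
      using xy by (intro walk_dist_triangle conn) auto
    also have "d x c = d c x" by (rule walk_dist_commute[OF sym_E])
    also have "d c x \<le> walk_dist (E \<inter> S \<times> S) c x"
      using that S by (intro walk_dist_antimono S.conn) auto
    also have "d c y \<le> walk_dist (E \<inter> T \<times> T) c y"
      using that T by (intro walk_dist_antimono T.conn) auto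
    finally have "d x y \<le> walk_dist (E \<inter> S \<times> S) c x + walk_dist (E \<inter> T \<times> T) c y"
      by simp
    then show ?thesis
      using d_ge_1[OF xy(1,3)] \<open>x \<noteq> y\<close> by (auto simp: g_def h_def intro: \<phi>_le)
  qed
  have g_commute: "g E u v = g E v u" for u v
    by (simp add: g_def walk_dist_commute[OF sym_E, of u v])
  have "dist_sum \<phi> V E = (\<Sum>u \<in> V. \<Sum>v \<in> V. g E u v)"
    using finite_V by (rule dist_sum_g)
  \<comment> \<open>The squares over \<open>S\<close> and \<open>T\<close> overlap only in
    \<open>(c, c)\<close>, where \<open>g\<close> has the value 0.\<close>
  also have "\<dots> = (\<Sum>u \<in> S. \<Sum>v \<in> S. g E u v) + (\<Sum>u \<in> T. \<Sum>v \<in> T. g E u v)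
    + (\<Sum>u \<in> A. \<Sum>v \<in> B. g E u v) + (\<Sum>u \<in> B. \<Sum>v \<in> A. g E u v)"
    unfolding V S T using fin c
    by (simp add: sum.union_disjoint sum.distrib) (simp add: g_def)
  also have "(\<Sum>u \<in> B. \<Sum>v \<in> A. g E u v) = (\<Sum>u \<in> A. \<Sum>v \<in> B. g E u v)"
    by (subst sum.swap) (simp add: g_commute[of _ _])
  also have "(\<Sum>u \<in> S. \<Sum>v \<in> S. g E u v) + (\<Sum>u \<in> T. \<Sum>v \<in> T. g E u v)
      + (\<Sum>u \<in> A. \<Sum>v \<in> B. g E u v) + (\<Sum>u \<in> A. \<Sum>v \<in> B. g E u v)
    \<le> (\<Sum>u \<in> S. \<Sum>v \<in> S. g (E \<inter> S \<times> S) u v) + (\<Sum>u \<in> T. \<Sum>v \<in> T. g (E \<inter> T \<times> T) u v)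
      + (\<Sum>u \<in> A. \<Sum>v \<in> B. h u v) + (\<Sum>u \<in> A. \<Sum>v \<in> B. h u v)"
    by (intro add_mono sum_mono g_S g_T cross)
  finally show ?thesis
    by (simp add: dist_sum_g S.finite_V T.finite_V h_def A_def B_def)
qed

end

text \<open>Strong induction on the number of vertices. \<open>glue\<close> is the numerical input
  for the particular \<open>\<phi>\<close>; being strict, it excludes equality for graphs with a cut
  vertex, so only the comparison of rows decides equality.\<close>

lemma dist_sum_le_cycle_sum:
  fixes \<phi> :: "nat \<Rightarrow> real" and V :: "'a set" and E :: "'a rel"
  assumes mono: "\<And>i j. 1 \<le> i \<Longrightarrow> i < j \<Longrightarrow> \<phi> i < \<phi> j"
    and glue: "\<And>S T :: 'a set. \<And>F H c. conn_graph S F \<Longrightarrow> bridgeless F \<Longrightarrow> c \<in> S \<Longrightarrow> card S \<ge> 3 \<Longrightarrow>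
      conn_graph T H \<Longrightarrow> bridgeless H \<Longrightarrow> c \<in> T \<Longrightarrow> card T \<ge> 3 \<Longrightarrow>
      cycle_sum \<phi> (card S) + cycle_sum \<phi> (card T)
        + 2 * (\<Sum>x \<in> S - {c}. \<Sum>y \<in> T - {c}. \<phi> (walk_dist F c x + walk_dist H c y))
      < cycle_sum \<phi> (card S + card T - 1)"
    and "conn_graph V E" "bridgeless E" "card V \<ge> 3"
  shows "dist_sum \<phi> V E \<le> cycle_sum \<phi> (card V) \<and>
    (dist_sum \<phi> V E = cycle_sum \<phi> (card V) \<longrightarrow> (\<forall>v \<in> V. card (E `` {v}) = 2))"
  using assms(3-5)
proof (induction "card V" arbitrary: V E rule: less_induct)
  case less
  interpret conn_graph V E by fact
  show ?case
  proof (cases "\<exists>c. cut_vertex V E c")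
    case True
    then obtain c S T where split: "S \<union> T = V" "S \<inter> T = {c}" "E \<subseteq> S \<times> S \<union> T \<times> T"
      and ne: "S \<noteq> {c}" "T \<noteq> {c}"
      using cut_vertex_split by metis
    let ?F = "E \<inter> S \<times> S" and ?H = "E \<inter> T \<times> T"
    have split': "T \<union> S = V" "T \<inter> S = {c}" "E \<subseteq> T \<times> T \<union> S \<times> S"
      using split by auto
    note S = conn_graph_part[OF split] bridgeless_part[OF split less(3)]
    note T = conn_graph_part[OF split'] bridgeless_part[OF split' less(3)]
    have c: "c \<in> S" "c \<in> T" using split(2) by auto
    have fin: "finite S" "finite T"
      using finite_V split(1) by auto
    have "card S > 1" "card T > 1"
      using c ne fin by
        (metis One_nat_def card_gt_0_iff card_1_singletonE empty_iff linorder_neqE_nat less_one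
          singletonD not_less_zero)+
    \<comment> \<open>Bridgeless graphs with at least two vertices have at least three, so
      \<open>glue\<close> and the induction hypothesis apply.\<close>
    then have card: "card S \<ge> 3" "card T \<ge> 3"
      using conn_graph.bridgeless_card_ge_3[OF S] conn_graph.bridgeless_card_ge_3[OF T] by simp_all
    have n: "card V = card S + card T - 1"
      using card_Un_Int[OF fin] split by simp
    with card have "card S < card V" "card T < card V" by linarith+
    then have "dist_sum \<phi> S ?F \<le> cycle_sum \<phi> (card S)" "dist_sum \<phi> T ?H \<le> cycle_sum \<phi> (card T)"
      using less(1)[OF _ S card(1)] less(1)[OF _ T card(2)] by simp_all
    moreover note dist_sum_split_le[where \<phi> = \<phi>, OF mono split]
    ultimately have "dist_sum \<phi> V E < cycle_sum \<phi> (card V)"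
      using glue[OF S c(1) card(1) T c(2) card(2)] unfolding n by linarith
    then show ?thesis by simp
  next
    case False
    let ?r = "\<Sum>i = 1..card V - 1. \<phi> ((i + 1) div 2)"
    have row: "(\<Sum>y \<in> V - {c}. \<phi> (d c y)) \<le> ?r" if "c \<in> V" for c
      using noncut_row_le(1)[of \<phi>, OF mono _ that] False by blast
    have cyc: "cycle_sum \<phi> (card V) = (\<Sum>c \<in> V. ?r)"
      by (simp add: cycle_sum_def)
    have "dist_sum \<phi> V E < cycle_sum \<phi> (card V)" if "v \<in> V" "card (E `` {v}) \<noteq> 2" for v
    proof -
      have "card (E `` {v}) \<ge> 3"
        using bridgeless_degree_ge_2[OF less(3) that(1)] less(4) that(2) by simp
      then have "(\<Sum>y \<in> V - {v}. \<phi> (d v y)) < ?r"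
        using noncut_row_le(2)[of \<phi>, OF mono _ that(1)] False by blast
      with that(1) row show ?thesis
        unfolding dist_sum_def cyc by (intro sum_strict_mono_ex1[OF finite_V]) blast+
    qed
    moreover have "dist_sum \<phi> V E \<le> cycle_sum \<phi> (card V)"
      unfolding dist_sum_def cyc using row by (rule sum_mono)
    ultimately show ?thesis by fastforce
  qed
qed

lemma (in conn_graph) two_regular_dist_sum_ge:
  fixes \<phi> :: "nat \<Rightarrow> real"
  assumes mono: "\<And>i j. 1 \<le> i \<Longrightarrow> i < j \<Longrightarrow> \<phi> i < \<phi> j"
    and reg: "\<And>v. v \<in> V \<Longrightarrow> card (E `` {v}) = 2"
  shows "cycle_sum \<phi> (card V) \<le> dist_sum \<phi> V E"
proof -
  have "cycle_sum \<phi> (card V) = (\<Sum>c \<in> V. \<Sum>i = 1..card V - 1. \<phi> ((i + 1) div 2))"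
    by (simp add: cycle_sum_def)
  also have "\<dots> \<le> dist_sum \<phi> V E"
    unfolding dist_sum_def using two_regular_row_ge[of \<phi>, OF mono reg] by (rule sum_mono)
  finally show ?thesis .
qed

context conn_graph
begin

text \<open>For \<open>real\<close> the cross sum separates, so only the distance sums from
  \<open>c\<close> matter and \<open>bridgeless_transmission_le\<close> suffices.\<close>

lemma dist_sum_real:
  assumes "bridgeless E" "card V \<ge> 3"
  shows "dist_sum real V E \<le> cycle_sum real (card V)"
    and "dist_sum real V E = cycle_sum real (card V) \<longleftrightarrow> (\<forall>v \<in> V. card (E `` {v}) = 2)"
proof -
  have "cycle_sum real (card S) + cycle_sum real (card T)
      + 2 * (\<Sum>x \<in> S - {c}. \<Sum>y \<in> T - {c}. real (walk_dist F c x + walk_dist H c y))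
    < cycle_sum real (card S + card T - 1)"
    if S: "conn_graph S F" "bridgeless F" "c \<in> S" "card S \<ge> 3"
      and T: "conn_graph T H" "bridgeless H" "c \<in> T" "card T \<ge> 3" for S T :: "'a set" and F H c
  proof -
    define a b where "a = card S - 1" and "b = card T - 1"
    have ab: "card S = a + 1" "card T = b + 1" "a \<ge> 2" "b \<ge> 2"
      using S(4) T(4) by (simp_all add: a_def b_def)
    define A where "A = (\<Sum>x \<in> S - {c}. real (walk_dist F c x))"
    define B where "B = (\<Sum>y \<in> T - {c}. real (walk_dist H c y))"
    have "card (S - {c}) = a" "card (T - {c}) = b"
      using S(3) T(3) ab by simp_all
    then have "(\<Sum>x \<in> S - {c}. \<Sum>y \<in> T - {c}. real (walk_dist F c x + walk_dist H c y))
      = real b * A + real a * B"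
      by (simp add: sum.distrib A_def B_def sum_distrib_left)
    moreover have "3 * A \<le> real (a\<^sup>2 + a)" "3 * B \<le> real (b\<^sup>2 + b)"
      unfolding A_def B_def
      using conn_graph.bridgeless_transmission_le[OF S(1-3) ab(1)]
        conn_graph.bridgeless_transmission_le[OF T(1-3) ab(2)] by simp_all
    ultimately show ?thesis
      using cycle_sum_real_superadditive[OF ab(3,4)] ab by simp
  qed
  note main = dist_sum_le_cycle_sum[of real, OF _ this conn_graph_axioms assms]
  show "dist_sum real V E \<le> cycle_sum real (card V)"
    using main by simp
  show "dist_sum real V E = cycle_sum real (card V) \<longleftrightarrow> (\<forall>v \<in> V. card (E `` {v}) = 2)"
    using main two_regular_dist_sum_ge[of real] by fastforce
qed

text \<open>Reciprocals of sums do not separate, so the distances in both parts are replaced by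
  \<open>rank_bound\<close>, one part after the other.\<close>

lemma dist_sum_recip:
  assumes "bridgeless E" "card V \<ge> 3"
  shows "cycle_sum recip (card V) \<le> dist_sum recip V E"
    and "dist_sum recip V E = cycle_sum recip (card V) \<longleftrightarrow> (\<forall>v \<in> V. card (E `` {v}) = 2)"
proof -
  let ?\<phi> = "\<lambda>k. - recip k"
  \<comment> \<open>Monotonicity fails at 0 because \<open>recip 0 = 0\<close>; hence all
    monotonicity hypotheses start at 1.\<close>
  have mono: "?\<phi> i < ?\<phi> j" if "1 \<le> i" "i < j" for i j
    using that by (simp add: frac_less2)
  have mono_le: "?\<phi> i \<le> ?\<phi> j" if "1 \<le> i" "i \<le> j" for i j
    using mono[of i j] that by (cases "i = j") auto
  have cyc: "cycle_sum ?\<phi> n = - cycle_sum recip n" for n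
    by (simp add: cycle_sum_def sum_negf)
  have dist: "dist_sum ?\<phi> V E = - dist_sum recip V E"
    by (simp add: dist_sum_def sum_negf)
  have "cycle_sum ?\<phi> (card S) + cycle_sum ?\<phi> (card T)
      + 2 * (\<Sum>x \<in> S - {c}. \<Sum>y \<in> T - {c}. ?\<phi> (walk_dist F c x + walk_dist H c y))
    < cycle_sum ?\<phi> (card S + card T - 1)"
    if S: "conn_graph S F" "bridgeless F" "c \<in> S" "card S \<ge> 3"
      and T: "conn_graph T H" "bridgeless H" "c \<in> T" "card T \<ge> 3" for S T :: "'a set" and F H c
  proof -
    define a b where "a = card S - 1" and "b = card T - 1"
    have ab: "card S = a + 1" "card T = b + 1" "a \<ge> 2" "b \<ge> 2"
      using S(4) T(4) by (simp_all add: a_def b_def)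
    have "(\<Sum>x \<in> S - {c}. \<Sum>y \<in> T - {c}. ?\<phi> (walk_dist F c x + walk_dist H c y))
      \<le> (\<Sum>x \<in> S - {c}. \<Sum>k = 1..card T - 1. ?\<phi> (walk_dist F c x + rank_bound k))"
      by (intro sum_mono conn_graph.bridgeless_row_le[OF T(1) _ T(2,3)] mono_le) auto
    \<comment> \<open>Here the inner sum over \<open>k\<close> takes the place of
      \<open>\<phi>\<close>.\<close>
    also have "\<dots> \<le> (\<Sum>i = 1..card S - 1. \<Sum>k = 1..card T - 1. ?\<phi> (rank_bound i + rank_bound k))"
      by (intro conn_graph.bridgeless_row_le[OF S(1) _ S(2,3),
        where \<phi> = "\<lambda>i. \<Sum>k = 1..card T - 1. ?\<phi> (i + rank_bound k)"]
        sum_mono mono_le) auto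
    also have "\<dots> = - (\<Sum>i = 1..a. \<Sum>k = 1..b. recip (rank_bound i + rank_bound k))"
      by (simp add: ab sum_negf)
    finally show ?thesis
      using cycle_sum_recip_subadditive[OF ab(3,4)] unfolding cyc by (simp add: ab)
  qed
  note main = dist_sum_le_cycle_sum[of ?\<phi>, OF mono this conn_graph_axioms assms]
  show "cycle_sum recip (card V) \<le> dist_sum recip V E"
    using main by (simp add: cyc dist)
  show "dist_sum recip V E = cycle_sum recip (card V) \<longleftrightarrow> (\<forall>v \<in> V. card (E `` {v}) = 2)"
    using main two_regular_dist_sum_ge[of ?\<phi>, OF mono] unfolding cyc dist by fastforce
qed

end

section \<open>Even and regular graphs\<close>

text \<open>The arcs are removed in opposite pairs; this becomes the handshake lemma once a degree
  sum is read as a number of arcs.\<close>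

lemma even_card_sym_irrefl:
  assumes "finite R" "sym R" "irrefl R"
  shows "even (card R)"
  using assms
proof (induction R rule: finite_psubset_induct)
  case (psubset R)
  show ?case
  proof (cases "R = {}")
    case False
    then obtain x y where xy: "(x, y) \<in> R" by auto
    then have yx: "(y, x) \<in> R" "x \<noteq> y"
      using psubset.prems by (auto dest: symD simp: irrefl_def)
    let ?R = "R - {(x, y), (y, x)}"
    have "?R \<subset> R" "sym ?R" "irrefl ?R"
      using xy psubset.prems by (auto simp: sym_def irrefl_def)
    then have "even (card ?R)"
      by (rule psubset.IH)
    moreover have "card R = card ?R + 2"
      using xy yx card_Diff_subset[of "{(x, y), (y, x)}" R] card_mono[OF psubset.hyps(1), of "{(x, y), (y, x)}"]
      by simp
    ultimately show ?thesis by simp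
  qed simp
qed

text \<open>If an edge were a bridge, the component \<open>S\<close> of \<open>x\<close> after its
  deletion would have exactly one vertex of odd degree, namely \<open>x\<close>, against the
  handshake lemma.\<close>

lemma even_degrees_bridgeless:
  assumes "finite E" "sym E" "irrefl E" and even: "\<And>v. even (card (E `` {v}))"
  shows "bridgeless E"
  unfolding bridgeless_def
proof clarify
  fix x y assume xy: "(x, y) \<in> E"
  then have "x \<noteq> y" using assms(3) by (auto simp: irrefl_def)
  define F where "F = E - {(x, y), (y, x)}"
  show "(x, y) \<in> (E - {(x, y), (y, x)})\<^sup>*"
  proof (rule ccontr)
    assume "\<not> ?thesis"
    then have y: "(x, y) \<notin> F\<^sup>*" by (simp add: F_def)
    define S where "S = {z. (x, z) \<in> F\<^sup>*}"
    have "finite F" using assms(1) by (simp add: F_def)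
    have "S \<subseteq> insert x (Range F)"
      by (auto simp: S_def elim: rtranclE)
    then have "finite S"
      using \<open>finite F\<close> by (auto intro: finite_subset simp: finite_Range)
    \<comment> \<open>Arcs of \<open>F\<close> that start in \<open>S\<close> also end
      there.\<close>
    have "Sigma S (\<lambda>z. F `` {z}) = F \<inter> S \<times> S"
      by (auto simp: S_def intro: rtrancl_into_rtrancl)
    moreover have "sym (F \<inter> S \<times> S)" "irrefl (F \<inter> S \<times> S)"
      using assms(2,3) by (auto simp: F_def sym_def irrefl_def)
    ultimately have "even (card (Sigma S (\<lambda>z. F `` {z})))"
      using \<open>finite F\<close> by (auto intro: even_card_sym_irrefl)
    also have "card (Sigma S (\<lambda>z. F `` {z})) = (\<Sum>z \<in> S. card (F `` {z}))"
      using \<open>finite S\<close> \<open>finite F\<close> by (intro card_SigmaI) auto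
    also have "\<dots> = card (F `` {x}) + (\<Sum>z \<in> S - {x}. card (F `` {z}))"
      using \<open>finite S\<close> by (intro sum.remove) (auto simp: S_def)
    finally have "even (card (F `` {x}) + (\<Sum>z \<in> S - {x}. card (F `` {z})))" .
    moreover have "even (\<Sum>z \<in> S - {x}. card (F `` {z}))"
    proof (rule dvd_sum)
      fix z assume "z \<in> S - {x}"
      then have "F `` {z} = E `` {z}"
        using y by (auto simp: F_def S_def)
      with even show "even (card (F `` {z}))" by simp
    qed
    moreover have "F `` {x} = E `` {x} - {y}"
      using \<open>x \<noteq> y\<close> by (auto simp: F_def)
    then have "card (E `` {x}) = Suc (card (F `` {x}))"
      using card.remove[of "E `` {x}" y] xy assms(1) by simp
    ultimately show False
      using even[of x] by simp
  qed
qed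

section \<open>Connected 2-regular graphs as cycles\<close>

lemma cyclic_neighbours:
  fixes i j n :: nat
  assumes "i < n" "j < n"
  shows "j = (i + 1) mod n \<or> i = (j + 1) mod n \<longleftrightarrow>
    j = (if i + 1 = n then 0 else i + 1) \<or> j = (if i = 0 then n - 1 else i - 1)"
proof -
  have "(k + 1) mod n = (if k + 1 = n then 0 else k + 1)" if "k < n" for k
    using that by simp
  with assms show ?thesis by auto
qed

text \<open>A walk that never turns back first repeats a vertex by returning to its start, as every
  later vertex already has both neighbours on the walk. The closed walk contains all neighbours of
  its vertices, so by connectedness it covers \<open>V\<close>.\<close>

lemma (in conn_graph) two_regular_cyclic_order:
  assumes reg: "\<And>v. v \<in> V \<Longrightarrow> card (E `` {v}) = 2" and "V \<noteq> {}"
  obtains p where "bij_betw p {0..<card V} V"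
    and "\<And>i j. i < card V \<Longrightarrow> j < card V \<Longrightarrow>
      (p i, p j) \<in> E \<longleftrightarrow> j = (i + 1) mod card V \<or> i = (j + 1) mod card V"
proof -
  obtain v0 where v0: "v0 \<in> V" using assms(2) by auto
  obtain v1 where v1: "(v0, v1) \<in> E"
    using reg[OF v0] by (metis Image_singleton_iff card.empty equals0I zero_neq_numeral)
  define other where "other u v = (SOME w. (v, w) \<in> E \<and> w \<noteq> u)" for u v
  have other: "E `` {v} = {u, other u v}" "other u v \<noteq> u" if uv: "(u, v) \<in> E" for u v
  proof -
    have vu: "u \<in> E `` {v}" and v: "v \<in> V"
      using uv sym_E E_in_V by (auto dest: symD)
    obtain a b where ab: "E `` {v} = {a, b}" "a \<noteq> b"
      using reg[OF v] by (auto simp: card_2_iff)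
    then have "\<exists>w. (v, w) \<in> E \<and> w \<noteq> u" by blast
    then have w: "(v, other u v) \<in> E \<and> other u v \<noteq> u"
      unfolding other_def by (rule someI_ex)
    then have "u \<in> {a, b}" "other u v \<in> {a, b}"
      using vu by (auto simp flip: ab(1))
    with w show "E `` {v} = {u, other u v}" "other u v \<noteq> u"
      unfolding ab(1) by auto
  qed
  \<comment> \<open>The state of the walk is its current arc, and \<open>p\<close> reads off the
    first vertex of that arc.\<close>
  define q where "q k = ((\<lambda>(u, v). (v, other u v)) ^^ k) (v0, v1)" for k
  define p where "p k = fst (q k)" for k
  have snd_q: "snd (q k) = p (Suc k)" for k
    by (simp add: p_def q_def case_prod_beta)
  have p_Suc_Suc: "p (Suc (Suc k)) = other (p k) (p (Suc k))" for k
    unfolding snd_q[symmetric] by (simp add: p_def q_def case_prod_beta)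
  have edge: "(p k, p (Suc k)) \<in> E" for k
  proof (induction k)
    case 0
    show ?case using v1 by (simp add: p_def q_def)
  next
    case (Suc k)
    show ?case
      using other(1)[OF Suc] unfolding p_Suc_Suc by auto
  qed
  have nbrs: "E `` {p (Suc k)} = {p k, p (Suc (Suc k))}" "p (Suc (Suc k)) \<noteq> p k" for k
    using other[OF edge[of k]] unfolding p_Suc_Suc by auto
  have p_V: "p k \<in> V" for k
    using edge E_in_V by blast
  have p_neq: "p (Suc k) \<noteq> p k" for k
    using edge[of k] irrefl_E by (auto simp: irrefl_def)
  have "\<exists>m. p m \<in> p ` {..<m}"
  proof (rule ccontr)
    assume new: "\<not> ?thesis"
    have "inj p"
    proof (rule injI)
      fix i j assume "p i = p j"
      with new show "i = j"
        by (metis imageI lessThan_iff linorder_neqE_nat)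
    qed
    moreover have "finite (range p)"
      using p_V finite_V by (auto intro: finite_subset)
    ultimately show False
      using finite_imageD by blast
  qed
  \<comment> \<open>\<open>m\<close> is the first index at which the walk meets an earlier
    vertex.\<close>
  then obtain m where m: "p m \<in> p ` {..<m}" and min: "\<And>k. k < m \<Longrightarrow> p k \<notin> p ` {..<k}"
    using exists_least_iff[of "\<lambda>m. p m \<in> p ` {..<m}"] by blast
  have inj: "inj_on p {..<m}"
  proof (rule inj_onI)
    fix i j assume "i \<in> {..<m}" "j \<in> {..<m}" "p i = p j"
    with min[of i] min[of j] show "i = j"
      by (metis imageI lessThan_iff linorder_neqE_nat)
  qed
  have inj_eq: "p i = p j \<longleftrightarrow> i = j" if "i < m" "j < m" for i j
    using inj that by (auto simp: inj_on_def)
  obtain i where i: "i < m" "p i = p m"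
    using m by auto
  \<comment> \<open>Otherwise \<open>p (m - 1)\<close> is one of the two neighbours of
    \<open>p i\<close> on the walk. Minimality of \<open>m\<close> then leaves a loop or a step
    back, both excluded.\<close>
  have "i = 0"
  proof (rule ccontr)
    assume "i \<noteq> 0"
    then obtain k where k: "i = Suc k" by (cases i) auto
    obtain l where l: "m = Suc l" using i(1) by (cases m) auto
    have "p l \<in> E `` {p (Suc l)}"
      using nbrs(1)[of l] by simp
    then have "p l = p k \<or> p l = p (Suc (Suc k))"
      using nbrs(1)[of k] i(2) k l by auto
    then show False
    proof
      assume "p l = p k"
      then show False using inj_eq[of l k] i(1) k l by simp
    next
      assume eq: "p l = p (Suc (Suc k))"
      show False
      proof (cases "Suc (Suc k) = m")
        case True
        then show False using nbrs(2)[of l] eq p_neq[of l] i l k by simp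
      next
        case False
        then have "l = Suc (Suc k)"
          using inj_eq[of l "Suc (Suc k)"] eq i(1) k l by simp
        then show False
          using nbrs(2)[of "Suc k"] i(2) k l by simp
      qed
    qed
  qed
  with i have p_m: "p m = p 0" "m > 0" by simp_all
  have m3: "m \<ge> 3"
  proof (rule ccontr)
    assume "\<not> m \<ge> 3"
    with p_m(2) have "m = Suc 0 \<or> m = Suc (Suc 0)" by auto
    with p_m p_neq[of 0] nbrs(2)[of 0] show False by auto
  qed
  then obtain l where l: "m = Suc l" "l \<ge> 2" by (cases m) auto
  have nbrs_p: "E `` {p i} = {p (if i + 1 = m then 0 else i + 1), p (if i = 0 then m - 1 else i - 1)}"
    if i: "i < m" for i
  proof (cases i)
    case 0
    have "E `` {p (Suc l)} = {p l, p (Suc (Suc l))}"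
      by (rule nbrs)
    moreover have "p 1 \<in> E `` {p 0}"
      using edge[of 0] by simp
    moreover have "p 1 \<noteq> p l"
      using inj_eq[of 1 l] l by simp
    ultimately have "E `` {p 0} = {p 1, p l}"
      using p_m(1) l(1) by auto
    with 0 l show ?thesis by simp
  next
    case (Suc k)
    then show ?thesis
      using nbrs(1)[of k] p_m(1) l(1) by auto
  qed
  have "V \<subseteq> p ` {..<m}"
  proof
    fix v assume "v \<in> V"
    then have "(p 0, v) \<in> E\<^sup>*"
      using conn p_V by blast
    then show "v \<in> p ` {..<m}"
    proof (rule rtrancl_invariant)
      show "p 0 \<in> p ` {..<m}" using m3 by auto
      fix u w assume "(u, w) \<in> E" "u \<in> p ` {..<m}"
      then obtain i where "i < m" "w \<in> E `` {p i}" by auto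
      then show "w \<in> p ` {..<m}"
        using nbrs_p[of i] m3 by (auto split: if_splits)
    qed
  qed
  then have bij: "bij_betw p {0..<m} V"
    using inj p_V by (auto simp: bij_betw_def lessThan_atLeast0)
  then have card: "card V = m"
    using bij_betw_same_card by fastforce
  show ?thesis
  proof (rule that[of p])
    show "bij_betw p {0..<card V} V"
      unfolding card by (rule bij)
    fix i j assume ij: "i < card V" "j < card V"
    define a b where "a = (if i + 1 = m then 0 else i + 1)" and "b = (if i = 0 then m - 1 else i - 1)"
    have ab: "a < m" "b < m"
      using ij m3 card by (auto simp: a_def b_def)
    have "(p i, p j) \<in> E \<longleftrightarrow> p j \<in> E `` {p i}" by simp
    also have "\<dots> \<longleftrightarrow> p j = p a \<or> p j = p b"
      using nbrs_p[of i] ij card by (simp add: a_def b_def)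
    also have "\<dots> \<longleftrightarrow> j = a \<or> j = b"
      using inj_eq ij card ab by simp
    also have "\<dots> \<longleftrightarrow> j = (i + 1) mod card V \<or> i = (j + 1) mod card V"
      unfolding cyclic_neighbours[OF ij] by (simp add: a_def b_def card)
    finally show "(p i, p j) \<in> E \<longleftrightarrow> j = (i + 1) mod card V \<or> i = (j + 1) mod card V" .
  qed
qed

section \<open>Topological indices of pair graphs\<close>

text \<open>Each 2-element set arises from exactly two ordered pairs.\<close>

lemma sum_two_subsets:
  fixes f :: "'a set \<Rightarrow> real"
  assumes "finite V"
  shows "(\<Sum>u \<in> V. \<Sum>v \<in> V - {u}. f {u, v}) = 2 * (\<Sum>e | e \<subseteq> V \<and> card e = 2. f e)"
proof -
  let ?P = "Sigma V (\<lambda>u. V - {u})" and ?T = "{e. e \<subseteq> V \<and> card e = 2}"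
  let ?g = "\<lambda>(u, v). {u, v}"
  have fibre: "(\<Sum>p | p \<in> ?P \<and> ?g p = e. f (?g p)) = 2 * f e" if e: "e \<in> ?T" for e
  proof -
    obtain a b where ab: "e = {a, b}" "a \<noteq> b" "a \<in> V" "b \<in> V"
      using e by (auto simp: card_2_iff)
    then have "{p. p \<in> ?P \<and> ?g p = e} = {(a, b), (b, a)}"
      by (auto simp: doubleton_eq_iff)
    then show ?thesis
      using ab by (simp add: insert_commute)
  qed
  have "(\<Sum>u \<in> V. \<Sum>v \<in> V - {u}. f {u, v}) = (\<Sum>p \<in> ?P. f (?g p))"
    using assms by (subst sum.Sigma) (auto simp: case_prod_beta)
  also have "\<dots> = (\<Sum>e \<in> ?T. \<Sum>p | p \<in> ?P \<and> ?g p = e. f (?g p))"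
    using assms by (intro sum.group[symmetric]) auto
  also have "\<dots> = 2 * (\<Sum>e \<in> ?T. f e)"
    unfolding sum_distrib_left by (rule sum.cong[OF refl fibre])
  finally show ?thesis .
qed

section \<open>Translating pair graphs into relations\<close>

context pair_graph
begin

lemma sym_parcs: "sym (parcs G)"
  using pair_sym_arcs by (simp add: symmetric_def)

text \<open>Connectedness is defined through the symmetric closure, which adds no arcs to a
  symmetric graph.\<close>

lemma connected_rtrancl:
  assumes "Digraph_Component.connected (with_proj G)" "u \<in> pverts G" "v \<in> pverts G"
  shows "(u, v) \<in> (parcs G)\<^sup>*"
proof -
  have "u \<rightarrow>\<^sup>*\<^bsub>mk_symmetric (with_proj G)\<^esub> v"
    using assms by (simp add: Digraph_Component.connected_def strongly_connected_def mk_symmetric_def)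
  then have "(u, v) \<in> (parcs (mk_symmetric (with_proj G)))\<^sup>*"
    using reachable_rtranclI by fastforce
  then show ?thesis
    using adj_mk_symmetric_eq[OF pair_sym_arcs] by simp
qed

lemma conn_graphI:
  assumes "Digraph_Component.connected (with_proj G)"
  shows "conn_graph (pverts G) (parcs G)"
proof
  show "irrefl (parcs G)"
    using pair_no_loops by (fastforce simp: irrefl_def)
qed (use sym_parcs connected_rtrancl[OF assms] in_arcsD1 in_arcsD2 in auto)

lemma awalk_relpow: "awalk u p v \<Longrightarrow> (u, v) \<in> parcs G ^^ length p"
proof (induction p arbitrary: u)
  case (Cons e p)
  then have "(u, snd e) \<in> parcs G" "(snd e, v) \<in> parcs G ^^ length p"
    by (auto simp: awalk_Cons_iff)
  then show ?case
    by (simp only: list.size(4) add_Suc_right add_0_right) (rule relpow_Suc_I2)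
qed (auto simp: awalk_Nil_iff)

lemma relpow_awalk:
  assumes "(u, v) \<in> parcs G ^^ k" "u \<in> pverts G"
  obtains p where "awalk u p v" "length p = k"
  using assms
proof (induction k arbitrary: u thesis)
  case 0
  then show ?case by (auto simp: awalk_Nil_iff intro: 0(1)[of "[]"])
next
  case (Suc k)
  obtain w where w: "(u, w) \<in> parcs G" "(w, v) \<in> parcs G ^^ k"
    using Suc.prems(2) by (blast elim: relpow_Suc_E2)
  moreover obtain p where "awalk w p v" "length p = k"
    using Suc.IH[of w] w in_arcsD2 by blast
  ultimately show ?case
    by (intro Suc.prems(1)[of "(u, w) # p"]) (auto simp: awalk_Cons_iff)
qed

text \<open>The infimum of unit-cost walks is attained by a shortest walk, as \<open>v\<close> is
  reachable; every other walk is at least as long.\<close>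

lemma graph_dist_eq_walk_dist:
  assumes "(u, v) \<in> (parcs G)\<^sup>*" "u \<in> pverts G"
  shows "graph_dist G u v = real (walk_dist (parcs G) u v)"
proof -
  have cost: "awalk_cost (\<lambda>_. 1) p = real (length p)" for p :: "('a \<times> 'a) list"
    by (induction p) auto
  have "\<mu> (\<lambda>_. 1) u v = ereal (real (walk_dist (parcs G) u v))"
  proof (rule antisym)
    obtain p where p: "awalk u p v" "length p = walk_dist (parcs G) u v"
      using relpow_awalk[OF relpow_walk_dist[OF assms(1)] assms(2)] .
    then show "\<mu> (\<lambda>_. 1) u v \<le> ereal (real (walk_dist (parcs G) u v))"
      using min_cost_le_walk_cost[OF p(1), of "\<lambda>_. 1"] by (simp add: cost)
    show "ereal (real (walk_dist (parcs G) u v)) \<le> \<mu> (\<lambda>_. 1) u v"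
      unfolding \<mu>_def by (intro INF_greatest) (auto simp: cost intro: walk_dist_le awalk_relpow)
  qed
  then show ?thesis by (simp add: graph_dist_def)
qed

text \<open>\<open>f\<close> extends \<open>\<phi>\<close> to real arguments because
  \<open>pair_dist\<close> is real-valued; the instances are the identity and the
  reciprocal.\<close>

lemma dist_sum_pair_dist:
  assumes "Digraph_Component.connected (with_proj G)" "\<And>k. \<phi> k = f (real k)"
  shows "dist_sum \<phi> (pverts G) (parcs G) = 2 * (\<Sum>e | e \<subseteq> pverts G \<and> card e = 2. f (pair_dist G e))"
proof -
  have "dist_sum \<phi> (pverts G) (parcs G) = (\<Sum>u \<in> pverts G. \<Sum>v \<in> pverts G - {u}. f (pair_dist G {u, v}))"
    unfolding dist_sum_def
    by (intro sum.cong refl)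
      (simp add: assms(2) pair_dist_eq[OF pair_graph_axioms] graph_dist_eq_walk_dist connected_rtrancl[OF assms(1)])
  also have "\<dots> = 2 * (\<Sum>e | e \<subseteq> pverts G \<and> card e = 2. f (pair_dist G e))"
    using pair_finite_verts by (rule sum_two_subsets)
  finally show ?thesis .
qed

lemma out_degree_eq: "out_degree (with_proj G) v = card (parcs G `` {v})"
proof -
  have "out_arcs (with_proj G) v = Pair v ` (parcs G `` {v})"
    by (auto simp: out_arcs_def)
  then show ?thesis
    by (simp add: out_degree_def card_image inj_on_def)
qed

lemma two_edge_connected_bridgeless:
  assumes "two_edge_connected G"
  shows "bridgeless (parcs G)"
  unfolding bridgeless_def
proof clarify
  fix x y assume xy: "(x, y) \<in> parcs G"
  interpret H: pair_graph "del_edge G x y"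
  proof
    show "symmetric (with_proj (del_edge G x y))"
      using sym_parcs by (auto simp: symmetric_def del_edge_def sym_def)
  qed (use in_arcsD1 in_arcsD2 pair_no_loops in \<open>auto simp: del_edge_def\<close>)
  have "(x, y) \<in> (parcs (del_edge G x y))\<^sup>*"
    using assms xy in_arcsD1[OF xy] in_arcsD2[OF xy]
    by (intro H.connected_rtrancl) (auto simp: two_edge_connected_def del_edge_def)
  then show "(x, y) \<in> (parcs G - {(x, y), (y, x)})\<^sup>*"
    by (simp add: del_edge_def)
qed

lemma eulerian_bridgeless:
  assumes "eulerian_graph G"
  shows "bridgeless (parcs G)"
proof (rule even_degrees_bridgeless)
  fix v
  show "even (card (parcs G `` {v}))"
  proof (cases "v \<in> pverts G")
    case True
    then show ?thesis
      using assms by (simp add: eulerian_graph_def out_degree_eq)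
  next
    case False
    then have "parcs G `` {v} = {}"
      using in_arcsD1 by auto
    then show ?thesis by simp
  qed
next
  show "irrefl (parcs G)"
    using pair_no_loops by (fastforce simp: irrefl_def)
qed (use pair_finite_arcs sym_parcs in auto)

lemma two_regular_iso_cycle:
  assumes "Digraph_Component.connected (with_proj G)" "card (pverts G) = n" "pverts G \<noteq> {}"
    and "\<And>v. v \<in> pverts G \<Longrightarrow> out_degree (with_proj G) v = 2"
  shows "digraph_iso (with_proj G) (with_proj (cycle_graph n))"
proof -
  interpret C: conn_graph "pverts G" "parcs G"
    using assms(1) by (rule conn_graphI)
  obtain p where bij: "bij_betw p {0..<n} (pverts G)"
    and adj: "\<And>i j. i < n \<Longrightarrow> j < n \<Longrightarrow> (p i, p j) \<in> parcs G \<longleftrightarrow> j = (i + 1) mod n \<or> i = (j + 1) mod n"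
    using C.two_regular_cyclic_order assms(2-4) unfolding out_degree_eq by metis
  define r where "r = inv_into {0..<n} p"
  have r: "bij_betw r (pverts G) {0..<n}"
    unfolding r_def using bij by (rule bij_betw_inv_into)
  have r_lt: "r v < n" and p_r: "p (r v) = v" if "v \<in> pverts G" for v
    using that r bij_betw_inv_into_right[OF bij that] by (auto simp: bij_betw_def r_def)
  have r_p: "r (p i) = i" if "i < n" for i
    using that bij_betw_inv_into_left[OF bij] by (simp add: r_def)
  define hom where "hom = \<lparr>iso_verts = r, iso_arcs = map_prod r r, iso_head = snd, iso_tail = fst\<rparr>"
  have inj: "inj_on r (pverts G)"
    using r by (simp add: bij_betw_def)
  then have "inj_on (map_prod r r) (parcs G)"
    using C.E_subset by (auto intro: inj_on_subset[OF map_prod_inj_on[OF inj inj]])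
  then have "digraph_isomorphism hom"
    unfolding digraph_isomorphism_def using inj wf_digraph_axioms by (simp add: hom_def)
  moreover have "parcs (cycle_graph n) = map_prod r r ` parcs G"
  proof
    show "map_prod r r ` parcs G \<subseteq> parcs (cycle_graph n)"
    proof (rule image_subsetI)
      fix e assume "e \<in> parcs G"
      moreover obtain u v where e: "e = (u, v)" by (cases e)
      ultimately have uv: "(u, v) \<in> parcs G" by simp
      then have "u \<in> pverts G" "v \<in> pverts G"
        using in_arcsD1 in_arcsD2 by auto
      then show "map_prod r r e \<in> parcs (cycle_graph n)"
        using adj[of "r u" "r v"] uv by (simp add: e cycle_graph_def r_lt p_r)
    qed
    show "parcs (cycle_graph n) \<subseteq> map_prod r r ` parcs G"
    proof (rule subrelI)
      fix i j assume "(i, j) \<in> parcs (cycle_graph n)"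
      then have "i < n" "j < n" "(p i, p j) \<in> parcs G"
        using adj by (auto simp: cycle_graph_def)
      then show "(i, j) \<in> map_prod r r ` parcs G"
        by (intro image_eqI[of _ _ "(p i, p j)"]) (simp_all add: r_p)
    qed
  qed
  then have "with_proj (cycle_graph n) = app_iso hom (with_proj G)"
    using r by (auto simp: app_iso_def hom_def with_proj_def cycle_graph_def bij_betw_def)
  ultimately show ?thesis
    unfolding digraph_iso_def by blast
qed

end

section \<open>The cycle graph and the comparison with it\<close>

lemma cycle_graph_degree:
  assumes "n \<ge> 3" "i < n"
  shows "card (parcs (cycle_graph n) `` {i}) = 2"
proof -
  have "parcs (cycle_graph n) `` {i} =
    {if i + 1 = n then 0 else i + 1, if i = 0 then n - 1 else i - 1}" (is "_ = ?N")
  proof (rule set_eqI)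
    fix j
    have "j < n" if "j \<in> ?N"
      using that assms by (auto split: if_splits)
    then show "j \<in> parcs (cycle_graph n) `` {i} \<longleftrightarrow> j \<in> ?N"
      using assms(2) cyclic_neighbours[OF assms(2), of j] by (auto simp: cycle_graph_def)
  qed
  then show ?thesis using assms by auto
qed

lemma cycle_graph_connected:
  assumes "n \<ge> 3"
  shows "Digraph_Component.connected (with_proj (cycle_graph n))"
proof -
  interpret pair_graph "cycle_graph n"
    using assms by (rule pair_graph_cycle_graph)
  let ?E = "parcs (cycle_graph n)"
  have "(0, i) \<in> ?E\<^sup>*" if "i < n" for i
    using that
  proof (induction i)
    case (Suc i)
    then have "(i, Suc i) \<in> ?E" by (simp add: cycle_graph_def)
    with Suc show ?case by (auto intro: rtrancl_into_rtrancl)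
  qed simp
  moreover have "sym (?E\<^sup>*)"
    using sym_parcs by (rule sym_rtrancl)
  ultimately have "(i, j) \<in> ?E\<^sup>*" if "i < n" "j < n" for i j
    using that by (meson rtrancl_trans symD)
  moreover have "pverts (cycle_graph n) = {0..<n}"
    by (simp add: cycle_graph_def)
  ultimately have "strongly_connected (with_proj (cycle_graph n))"
    using assms by (auto simp: strongly_connected_def reachable_conv)
  then show ?thesis
    unfolding Digraph_Component.connected_def strongly_connected_def
    using reachable_mk_symmetric_eq[OF pair_sym_arcs] by (simp add: mk_symmetric_def)
qed

lemma cycle_graph_eulerian: "n \<ge> 3 \<Longrightarrow> eulerian_graph (cycle_graph n)"
  using cycle_graph_connected cycle_graph_degree
    pair_graph.out_degree_eq[OF pair_graph_cycle_graph]
  by (simp add: eulerian_graph_def) (simp add: cycle_graph_def)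

lemma iso_cycle_two_regular:
  assumes "n \<ge> 3" "pair_graph G" "digraph_iso (with_proj G) (with_proj (cycle_graph n))"
    and v: "v \<in> pverts G"
  shows "out_degree (with_proj G) v = 2"
proof -
  interpret pair_graph G by fact
  obtain hom where hom: "digraph_isomorphism hom" "with_proj (cycle_graph n) = app_iso hom (with_proj G)"
    using assms(3) unfolding digraph_iso_def by blast
  have "iso_verts hom v \<in> verts (with_proj (cycle_graph n))"
    unfolding hom(2) using v by simp
  then have "iso_verts hom v < n"
    by (simp add: cycle_graph_def)
  moreover have "out_degree (with_proj G) v = out_degree (with_proj (cycle_graph n)) (iso_verts hom v)"
    unfolding hom(2) using out_degree_app_iso_eq[OF hom(1)] v by simp
  ultimately show ?thesis
    using pair_graph.out_degree_eq[OF pair_graph_cycle_graph[OF assms(1)]]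
      cycle_graph_degree[OF assms(1)] by simp
qed

text \<open>Equality is expressed by 2-regularity and the bounds by \<open>cycle_sum\<close>, so
  that the same statement serves \<open>G\<close> and the cycle itself.\<close>

lemma index_bounds:
  assumes "pair_graph G" "card (pverts G) = n" "n \<ge> 3" "eulerian_graph G \<or> two_edge_connected G"
  shows "2 * wiener_index G \<le> cycle_sum real n"
    and "2 * wiener_index G = cycle_sum real n \<longleftrightarrow> (\<forall>v \<in> pverts G. out_degree (with_proj G) v = 2)"
    and "cycle_sum recip n \<le> 2 * harary_index G"
    and "2 * harary_index G = cycle_sum recip n \<longleftrightarrow> (\<forall>v \<in> pverts G. out_degree (with_proj G) v = 2)"
    and "4 * n \<le> first_zagreb_index G"
    and "first_zagreb_index G = 4 * n \<longleftrightarrow> (\<forall>v \<in> pverts G. out_degree (with_proj G) v = 2)"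
proof -
  interpret pair_graph G by fact
  have con: "Digraph_Component.connected (with_proj G)"
    using assms(4) by (auto simp: eulerian_graph_def two_edge_connected_def)
  interpret C: conn_graph "pverts G" "parcs G"
    using con by (rule conn_graphI)
  have bridgeless: "bridgeless (parcs G)"
    using assms(4) eulerian_bridgeless two_edge_connected_bridgeless by blast
  have card: "card (pverts G) \<ge> 3" using assms by simp
  have W: "dist_sum real (pverts G) (parcs G) = 2 * wiener_index G"
    using dist_sum_pair_dist[OF con, of real "\<lambda>x. x"] by (simp add: wiener_index_def)
  have H: "dist_sum recip (pverts G) (parcs G) = 2 * harary_index G"
    using dist_sum_pair_dist[OF con, of recip "\<lambda>x. 1 / x"] by (simp add: harary_index_def)
  show "2 * wiener_index G \<le> cycle_sum real n"
    "2 * wiener_index G = cycle_sum real n \<longleftrightarrow> (\<forall>v \<in> pverts G. out_degree (with_proj G) v = 2)"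
    using C.dist_sum_real[OF bridgeless card] assms(2) by (simp_all only: W out_degree_eq)
  show "cycle_sum recip n \<le> 2 * harary_index G"
    "2 * harary_index G = cycle_sum recip n \<longleftrightarrow> (\<forall>v \<in> pverts G. out_degree (with_proj G) v = 2)"
    using C.dist_sum_recip[OF bridgeless card] assms(2) by (simp_all only: H out_degree_eq)
  have deg: "2 \<le> out_degree (with_proj G) v" if "v \<in> pverts G" for v
    using C.bridgeless_degree_ge_2[OF bridgeless that] card by (simp add: out_degree_eq)
  have sq: "4 \<le> (out_degree (with_proj G) v)\<^sup>2" if "v \<in> pverts G" for v
    using power_mono[OF deg[OF that], of 2] by simp
  have n: "4 * n = (\<Sum>v \<in> pverts G. 4)"
    using assms(2) by simp
  show "4 * n \<le> first_zagreb_index G"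
    unfolding first_zagreb_index_def n using sq by (rule sum_mono)
  show "first_zagreb_index G = 4 * n \<longleftrightarrow> (\<forall>v \<in> pverts G. out_degree (with_proj G) v = 2)"
  proof
    assume "\<forall>v \<in> pverts G. out_degree (with_proj G) v = 2"
    then show "first_zagreb_index G = 4 * n"
      by (simp add: first_zagreb_index_def assms(2))
  next
    assume eq: "first_zagreb_index G = 4 * n"
    show "\<forall>v \<in> pverts G. out_degree (with_proj G) v = 2"
    proof (rule ccontr)
      assume "\<not> ?thesis"
      then obtain v where v: "v \<in> pverts G" "out_degree (with_proj G) v \<noteq> 2" by blast
      then have "2\<^sup>2 < (out_degree (with_proj G) v)\<^sup>2"
        using deg[OF v(1)] by (intro power_strict_mono) auto
      then have "(\<Sum>v \<in> pverts G. 4) < (\<Sum>v \<in> pverts G. (out_degree (with_proj G) v)\<^sup>2)"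
        using sq v(1) by (intro sum_strict_mono_ex1) auto
      with eq show False
        unfolding first_zagreb_index_def n by simp
    qed
  qed
qed

theorem theorem1:
  fixes G :: "'a pair_pre_digraph" and n :: nat
  assumes "n \<ge> 3"
    and "pair_graph G"
    and "card (pverts G) = n"
    and "eulerian_graph G \<or> two_edge_connected G"
  shows "wiener_index G \<le> wiener_index (cycle_graph n) \<and>
         harary_index G \<ge> harary_index (cycle_graph n) \<and>
         first_zagreb_index G \<ge> first_zagreb_index (cycle_graph n) \<and>
         (wiener_index G = wiener_index (cycle_graph n) \<longleftrightarrow>
            digraph_iso (with_proj G) (with_proj (cycle_graph n))) \<and>
         (harary_index G = harary_index (cycle_graph n) \<longleftrightarrow>
            digraph_iso (with_proj G) (with_proj (cycle_graph n))) \<and>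
         (first_zagreb_index G = first_zagreb_index (cycle_graph n) \<longleftrightarrow>
            digraph_iso (with_proj G) (with_proj (cycle_graph n)))"
proof -
  note G = index_bounds[OF assms(2,3,1,4)]
  have "pair_graph (cycle_graph n)" "card (pverts (cycle_graph n)) = n" "eulerian_graph (cycle_graph n)"
    using pair_graph_cycle_graph cycle_graph_eulerian assms(1) by (auto simp: cycle_graph_def)
  \<comment> \<open>The indices of the cycle are read off from the equality clauses for this
    Eulerian 2-regular graph, without computing its distances.\<close>
  note C = index_bounds[OF this(1,2) assms(1) disjI1[OF this(3)]]
  have reg: "\<forall>v \<in> pverts (cycle_graph n). out_degree (with_proj (cycle_graph n)) v = 2"
    using cycle_graph_degree[OF assms(1)]
    by (simp add: pair_graph.out_degree_eq[OF pair_graph_cycle_graph[OF assms(1)]]) (simp add: cycle_graph_def)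
  have "Digraph_Component.connected (with_proj G)" "pverts G \<noteq> {}"
    using assms by (auto simp: eulerian_graph_def two_edge_connected_def)
  then have iso: "digraph_iso (with_proj G) (with_proj (cycle_graph n)) \<longleftrightarrow>
      (\<forall>v \<in> pverts G. out_degree (with_proj G) v = 2)"
    using pair_graph.two_regular_iso_cycle[OF assms(2) _ assms(3)] iso_cycle_two_regular[OF assms(1,2)]
    by blast
  have "2 * wiener_index (cycle_graph n) = cycle_sum real n"
    "2 * harary_index (cycle_graph n) = cycle_sum recip n"
    "first_zagreb_index (cycle_graph n) = 4 * n"
    using C(2,4,6) reg by blast+
  with G show ?thesis
    unfolding iso by (smt (verit))
qed

end
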